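(* Let $m,n\geq 3$ be integers and $p=(m-1)(n-1)+1$. Then $\mathbb{R}^{m\times n\times p}$ has plural typical ranks if $m-1$ and $n-1$ are not bit-disjoint.
   Context: $\mathbb{R}^{m\times n\times p}$ is the space of real $m\times n\times p$ tensors (3-way arrays) with the Euclidean topology. The rank of a tensor $T$ is the minimal $r$ such that $T$ is a sum of $r$ tensors of the form $\mathbf{a}\otimes\mathbf{b}\otimes\mathbf{c}$ with $\mathbf{a}\in\mathbb{R}^m$, $\mathbf{b}\in\mathbb{R}^n$, $\mathbf{c}\in\mathbb{R}^p$. An integer $r$ is a typical rank of $\mathbb{R}^{m\times n\times p}$ if the set of tensors of rank $r$ contains a nonempty open subset of $\mathbb{R}^{m\times n\times p}$. "Plural typical ranks" means at least two distinct typical ranks. Two integers $a,b$ with dyadic expansions $a=\sum_j\alpha_j(a)2^j$, $b=\sum_j\alpha_j(b)2^j$ ($\alpha_j\in\{0,1\}$) are bit-disjoint if the sets $\{j\mid\alpha_j(a)=1\}$ and $\{j\mid\alpha_j(b)=1\}$ are disjoint. *)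

theory Defs
  imports "HOL-Analysis.Analysis"
begin

text \<open>
  The entry of index \<open>(i, j, k)\<close> of an \<open>m \<times> n \<times> p\<close> tensor \<open>T\<close> is \<open>T $ i $ j $ k\<close>; with the
  nesting used by \<open>(^)\<close> on types, \<open>m\<close>, \<open>n\<close>, \<open>p\<close> are the cardinalities of \<open>'m\<close>, \<open>'n\<close>, \<open>'p\<close>.
\<close>

type_synonym ('m, 'n, 'p) tensor3 = "real ^ 'p ^ 'n ^ 'm"

definition outer3 ::
    "real ^ 'm \<Rightarrow> real ^ 'n \<Rightarrow> real ^ 'p \<Rightarrow> ('m::finite, 'n::finite, 'p::finite) tensor3" where
  "outer3 a b c = (\<chi> i j k. a $ i * b $ j * c $ k)"

definition sum_of_outer3 :: "nat \<Rightarrow> ('m::finite, 'n::finite, 'p::finite) tensor3 \<Rightarrow> bool" where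
  "sum_of_outer3 r T \<longleftrightarrow>
    (\<exists>(a :: nat \<Rightarrow> real ^ 'm) (b :: nat \<Rightarrow> real ^ 'n) (c :: nat \<Rightarrow> real ^ 'p).
      T = (\<Sum>l<r. outer3 (a l) (b l) (c l)))"

definition tensor_rank :: "('m::finite, 'n::finite, 'p::finite) tensor3 \<Rightarrow> nat" where
  "tensor_rank T = (LEAST r. sum_of_outer3 r T)"

text \<open>The minimum in the definition of the rank is over a nonempty set.\<close>

lemma ex_sum_of_outer3:
  fixes T :: "('m::finite, 'n::finite, 'p::finite) tensor3"
  shows "\<exists>r. sum_of_outer3 r T"
proof -
  let ?I = "UNIV :: ('m \<times> 'n \<times> 'p) set"
  let ?t = "\<lambda>(i, j, k). outer3 (axis i (T $ i $ j $ k)) (axis j 1) (axis k 1) :: ('m, 'n, 'p) tensor3"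
  obtain h where h: "bij_betw h {..<card ?I} ?I"
    using ex_bij_betw_nat_finite[of ?I] by (auto simp: atLeast0LessThan)
  have "T $ i $ j $ k = (\<Sum>x\<in>?I. ?t x) $ i $ j $ k" for i j k
  proof -
    have "(\<Sum>x\<in>?I. ?t x) $ i $ j $ k = (\<Sum>x\<in>?I. ?t x $ i $ j $ k)"
      by (simp only: sum_component)
    also have "\<dots> = (\<Sum>x\<in>?I. if x = (i, j, k) then T $ i $ j $ k else 0)"
    proof (rule sum.cong)
      fix x :: "'m \<times> 'n \<times> 'p"
      show "?t x $ i $ j $ k = (if x = (i, j, k) then T $ i $ j $ k else 0)"
        by (cases x) (simp add: outer3_def axis_def)
    qed simp
    also have "\<dots> = T $ i $ j $ k"
      by (subst sum.delta) auto
    finally show ?thesis ..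
  qed
  then have "T = (\<Sum>x\<in>?I. ?t x)"
    unfolding vec_eq_iff by blast
  also have "\<dots> = (\<Sum>l<card ?I. ?t (h l))"
    by (rule sum.reindex_bij_betw[OF h, symmetric])
  finally have "sum_of_outer3 (card ?I) T"
    unfolding sum_of_outer3_def
    by (intro exI[of _ "\<lambda>l. case h l of (i, j, k) \<Rightarrow> axis i (T $ i $ j $ k)"]
        exI[of _ "\<lambda>l. case h l of (i, j, k) \<Rightarrow> axis j 1"]
        exI[of _ "\<lambda>l. case h l of (i, j, k) \<Rightarrow> axis k 1"])
      (simp only: case_prod_beta)
  then show ?thesis ..
qed

definition typical_rank :: "('m::finite, 'n::finite, 'p::finite) tensor3 itself \<Rightarrow> nat \<Rightarrow> bool" where
  "typical_rank _ r \<longleftrightarrow>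
    (\<exists>U :: ('m, 'n, 'p) tensor3 set. open U \<and> U \<noteq> {} \<and> U \<subseteq> {T. tensor_rank T = r})"

definition plural_typical_ranks :: "('m::finite, 'n::finite, 'p::finite) tensor3 itself \<Rightarrow> bool" where
  "plural_typical_ranks t \<longleftrightarrow> (\<exists>r s. r \<noteq> s \<and> typical_rank t r \<and> typical_rank t s)"

text \<open>\<open>bit a j\<close> holds iff the coefficient of \<open>2 ^ j\<close> in the dyadic expansion of \<open>a\<close> is \<open>1\<close>.\<close>

definition bit_disjoint :: "nat \<Rightarrow> nat \<Rightarrow> bool" where
  "bit_disjoint a b \<longleftrightarrow> {j. bit a j} \<inter> {j. bit b j} = {}"

end

theory Submission
  imports Defs "HOL-Computational_Algebra.Polynomial_Factorial" "HOL-Computational_Algebra.Field_as_Ring"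
begin

text \<open>
  Write \<open>a = m - 1\<close> and \<open>b = n - 1\<close>, so that \<open>p = a b + 1\<close>. A tensor is read as a linear map
  \<open>d \<mapsto> contract T d\<close> from \<open>\<real>\<^sup>p\<close> to the \<open>m \<times> n\<close> matrices; a sum of \<open>r\<close> elementary tensors gives a map
  whose values are combinations of \<open>r\<close> matrices of rank one, with coefficients linear in \<open>d\<close>.

  The number \<open>p\<close> is a typical rank because the map from \<open>p\<close> triples of vectors to the sum of their
  elementary tensors is a submersion at some point whose image gives an injective contraction
  (\<open>exists_submersive_factors\<close>, \<open>typical_rank_card\<close>).

  For a second typical rank it is enough to find a tensor whose image under contraction has
  dimension \<open>p\<close> and contains no matrix of rank one. This property is open, and it excludes rank \<open>\<le> p\<close>:
  some \<open>d \<noteq> 0\<close> is orthogonal to all but one of the third factors of at most \<open>p\<close> elementary tensors, and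
  then the contraction with \<open>d\<close> has rank at most one (\<open>rank_gt_if_avoids_rank_one\<close>). On an open set of
  tensors of rank at least \<open>p\<close>, the least rank \<open>r\<close> that occurs is typical: the first \<open>p\<close> terms of a
  decomposition with \<open>r\<close> terms can be moved slightly to a submersive point, after which the sums of
  \<open>r\<close> terms fill a neighbourhood (\<open>exists_typical_rank_on_open\<close>).

  A \<open>p\<close>-dimensional space of matrices without elements of rank one is cut out by \<open>m n - p = a + b\<close> bilinear
  forms on \<open>\<real>\<^sup>m \<times> \<real>\<^sup>n\<close> that have no common zero with both arguments nonzero. If \<open>a\<close> and \<open>b\<close> have a
  common dyadic digit, such forms are obtained as follows. Identify \<open>\<real>\<^sup>m\<close> and \<open>\<real>\<^sup>n\<close> with the polynomials of
  degree at most \<open>a\<close> and \<open>b\<close>, and split \<open>x = x\<^sub>0(t\<^sup>2) + t x\<^sub>1(t\<^sup>2)\<close>. Define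
  \<open>\<phi>(x, y)\<close> as the polynomial \<open>x\<^sub>0 y\<^sub>1 - x\<^sub>1 y\<^sub>0\<close> followed by \<open>\<phi>(x\<^sub>0, y\<^sub>0) + \<phi>(x\<^sub>1, y\<^sub>1)\<close>, where the latter
  belongs to the halved degrees, and as the product for constants. The number of coefficients is
  \<open>a + b + 1\<close> minus the number of common dyadic digits of \<open>a\<close> and \<open>b\<close>; only the resulting inequality is
  recorded (\<open>pairing_dim_le_if_common_bit\<close>).

  That \<open>\<phi>(p, q) = 0\<close> forces \<open>p = 0\<close> or \<open>q = 0\<close> is proved in a form that survives the recursion: for
  nonzero \<open>p\<close> and \<open>q\<close>, the vectors \<open>\<phi>(p g, q g)\<close> behave like squares of \<open>g\<close>, so that a finite sum of
  them vanishes only if every \<open>g\<close> does (\<open>pairing_definite\<close>). The determinant in \<open>\<phi>(p g, q g)\<close> is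
  \<open>g\<^sub>0\<^sup>2 - s g\<^sub>1\<^sup>2\<close> times that of \<open>(p, q)\<close>, and \<open>g\<^sub>0\<^sup>2 - s g\<^sub>1\<^sup>2\<close> is a positive definite form in
  \<open>(g\<^sub>0, g\<^sub>1)\<close> for \<open>s < 0\<close>. If the determinant of \<open>(p, q)\<close> vanishes, then \<open>p = P(t\<^sup>2) k\<close> and
  \<open>q = Q(t\<^sup>2) k\<close>, and the rest of \<open>\<phi>\<close> is the same kind of sum for \<open>P\<close>, \<open>Q\<close> and the even and odd
  parts of the polynomials \<open>k g\<close>.
\<close>

section \<open>Even and odd parts of a polynomial\<close>

definition even_part :: "real poly \<Rightarrow> real poly" where
  "even_part x = (\<Sum>i\<le>degree x. monom (coeff x (2 * i)) i)"

definition odd_part :: "real poly \<Rightarrow> real poly" where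
  "odd_part x = (\<Sum>i\<le>degree x. monom (coeff x (2 * i + 1)) i)"

lemma coeff_even_part: "coeff (even_part x) i = coeff x (2 * i)"
proof -
  have "coeff (even_part x) i = (\<Sum>k\<le>degree x. if k = i then coeff x (2 * k) else 0)"
    unfolding even_part_def coeff_sum by (intro sum.cong) auto
  also have "\<dots> = coeff x (2 * i)"
    by (auto simp: sum.delta coeff_eq_0)
  finally show ?thesis .
qed

lemma coeff_odd_part: "coeff (odd_part x) i = coeff x (2 * i + 1)"
proof -
  have "coeff (odd_part x) i = (\<Sum>k\<le>degree x. if k = i then coeff x (2 * k + 1) else 0)"
    unfolding odd_part_def coeff_sum by (intro sum.cong) auto
  also have "\<dots> = coeff x (2 * i + 1)"
    by (auto simp: sum.delta coeff_eq_0)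
  finally show ?thesis .
qed

lemma even_part_add: "even_part (x + y) = even_part x + even_part y"
  and odd_part_add: "odd_part (x + y) = odd_part x + odd_part y"
  and even_part_smult: "even_part (smult c x) = smult c (even_part x)"
  and odd_part_smult: "odd_part (smult c x) = smult c (odd_part x)"
  and even_part_pCons: "even_part (pCons c x) = pCons c (odd_part x)"
  and odd_part_pCons: "odd_part (pCons c x) = even_part x"
  by (auto simp: poly_eq_iff coeff_even_part coeff_odd_part coeff_pCons split: nat.split)

lemma even_part_0 [simp]: "even_part 0 = 0" and odd_part_0 [simp]: "odd_part 0 = 0"
  by (simp_all add: poly_eq_iff coeff_even_part coeff_odd_part)

lemma poly_even_odd: "poly x t = poly (even_part x) (t\<^sup>2) + t * poly (odd_part x) (t\<^sup>2)"
proof (induction x)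
  case (pCons c x)
  then show ?case
    by (simp add: even_part_pCons odd_part_pCons algebra_simps power2_eq_square)
qed simp

lemma poly_eq_if_squares:
  assumes "\<And>t. poly g (t\<^sup>2) = poly h (t\<^sup>2)"
  shows "g = (h :: real poly)"
proof -
  have "g - h = 0"
  proof (rule ccontr)
    assume "g - h \<noteq> 0"
    then have "finite {s. poly (g - h) s = 0}" by (rule poly_roots_finite)
    moreover have "{0..} \<subseteq> {s. poly (g - h) s = 0}"
    proof
      fix s :: real assume "s \<in> {0..}"
      then show "s \<in> {s. poly (g - h) s = 0}"
        using assms[of "sqrt s"] by simp
    qed
    ultimately show False
      using infinite_Ici[of "0::real"] finite_subset by blast
  qed
  then show ?thesis by simp
qed

text \<open>
  Evaluation at \<open>t\<close> and \<open>- t\<close> separates the two parts, and a polynomial is determined by its values at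
  the squares. This reduces the multiplication rules below to identities between numbers.
\<close>

lemma even_odd_unique:
  assumes "\<And>t. poly x t = poly g (t\<^sup>2) + t * poly h (t\<^sup>2)"
  shows "even_part x = g" and "odd_part x = h"
proof -
  have *: "poly (even_part x) (t\<^sup>2) + t * poly (odd_part x) (t\<^sup>2) = poly g (t\<^sup>2) + t * poly h (t\<^sup>2)" for t
    using assms poly_even_odd by metis
  have e: "poly (even_part x) (t\<^sup>2) = poly g (t\<^sup>2)" for t
    using *[of t] *[of "- t"] by simp
  then show "even_part x = g" by (rule poly_eq_if_squares)
  then have "t * poly (odd_part x) (t\<^sup>2) = t * poly h (t\<^sup>2)" for t
    using *[of t] by simp
  then have "poly (pCons 0 (odd_part x)) (t\<^sup>2) = poly (pCons 0 h) (t\<^sup>2)" for t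
    by (cases "t = 0") auto
  then have "pCons 0 (odd_part x) = pCons 0 h" by (rule poly_eq_if_squares)
  then show "odd_part x = h" by simp
qed

lemma even_part_mult: "even_part (x * y) = even_part x * even_part y + [:0, 1:] * (odd_part x * odd_part y)"
  and odd_part_mult: "odd_part (x * y) = even_part x * odd_part y + odd_part x * even_part y"
proof -
  have *: "poly (x * y) t = poly (even_part x * even_part y + [:0, 1:] * (odd_part x * odd_part y)) (t\<^sup>2)
      + t * poly (even_part x * odd_part y + odd_part x * even_part y) (t\<^sup>2)" for t
    unfolding poly_mult poly_add poly_even_odd[of x t] poly_even_odd[of y t]
    by (simp add: algebra_simps power2_eq_square)
  from even_odd_unique[OF *]
  show "even_part (x * y) = even_part x * even_part y + [:0, 1:] * (odd_part x * odd_part y)"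
   and "odd_part (x * y) = even_part x * odd_part y + odd_part x * even_part y" .
qed

lemma even_odd_eq_0D: "even_part x = 0 \<Longrightarrow> odd_part x = 0 \<Longrightarrow> x = 0"
  by (rule poly_eq_poly_eq_iff[THEN iffD1]) (simp add: fun_eq_iff poly_even_odd[of x])

definition interleave :: "real poly \<Rightarrow> real poly \<Rightarrow> real poly" where
  "interleave g h = g \<circ>\<^sub>p [:0, 0, 1:] + [:0, 1:] * (h \<circ>\<^sub>p [:0, 0, 1:])"

lemma even_part_interleave: "even_part (interleave g h) = g"
  and odd_part_interleave: "odd_part (interleave g h) = h"
proof -
  have *: "poly (interleave g h) t = poly g (t\<^sup>2) + t * poly h (t\<^sup>2)" for t
    by (simp add: interleave_def poly_pcompose power2_eq_square)
  from even_odd_unique[OF *] show "even_part (interleave g h) = g" "odd_part (interleave g h) = h" .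
qed

section \<open>A nonsingular pairing of polynomials\<close>

text \<open>
  The coefficients of the determinant \<open>x\<^sub>0 y\<^sub>1 - x\<^sub>1 y\<^sub>0\<close> occupy the positions below
  \<open>(a + b + 1) div 2\<close> as soon as \<open>degree x \<le> a\<close> and \<open>degree y \<le> b\<close>. Multiplication by the monomial
  therefore places the recursive part in separate coordinates. For \<open>a = b = 1\<close> this is the
  multiplication of complex numbers with the first factor conjugated, and for \<open>a = b = 2\<close> a map
  \<open>\<real>\<^sup>3 \<times> \<real>\<^sup>3 \<rightarrow> \<real>\<^sup>4\<close>.
\<close>

function pairing :: "nat \<Rightarrow> nat \<Rightarrow> real poly \<Rightarrow> real poly \<Rightarrow> real poly" where
  "pairing a b x y =
    (if a = 0 \<and> b = 0 then [:coeff x 0 * coeff y 0:]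
     else even_part x * odd_part y - odd_part x * even_part y
       + monom 1 ((a + b + 1) div 2) *
         (pairing (a div 2) (b div 2) (even_part x) (even_part y)
          + pairing (a div 2) (b div 2) (odd_part x) (odd_part y)))"
  by pat_completeness auto
termination
  by (relation "Wellfounded.measure (\<lambda>(a, b, _, _). a + b)") auto

declare pairing.simps [simp del]

lemma pairing_base: "pairing 0 0 x y = [:coeff x 0 * coeff y 0:]"
  by (simp add: pairing.simps)

lemma pairing_step:
  assumes "\<not> (a = 0 \<and> b = 0)"
  shows "pairing a b x y =
    even_part x * odd_part y - odd_part x * even_part y
       + monom 1 ((a + b + 1) div 2) *
         (pairing (a div 2) (b div 2) (even_part x) (even_part y)
          + pairing (a div 2) (b div 2) (odd_part x) (odd_part y))"
  using assms by (subst pairing.simps) (simp only: if_False)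

text \<open>
  This bounds the number of coefficients of \<open>pairing a b x y\<close>. Its closed form is \<open>a + b + 1\<close> minus the
  number of common dyadic digits of \<open>a\<close> and \<open>b\<close>: halving loses \<open>(a + b + 1) div 2\<close>, which is
  \<open>a div 2 + b div 2\<close> plus one if \<open>a\<close> or \<open>b\<close> is odd, so exactly the step with both odd gains one.
\<close>

function pairing_dim :: "nat \<Rightarrow> nat \<Rightarrow> nat" where
  "pairing_dim a b = (if a = 0 \<and> b = 0 then 1 else (a + b + 1) div 2 + pairing_dim (a div 2) (b div 2))"
  by pat_completeness auto
termination
  by (relation "Wellfounded.measure (\<lambda>(a, b). a + b)") auto

declare pairing_dim.simps [simp del]

lemma pairing_add_left: "pairing a b (x + x') y = pairing a b x y + pairing a b x' y"
proof (induction a b x y arbitrary: x' rule: pairing.induct)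
  case (1 a b x y)
  show ?case
  proof (cases "a = 0 \<and> b = 0")
    case True
    then show ?thesis by (simp add: pairing_base smult_add_right algebra_simps)
  next
    case False
    then show ?thesis using 1[OF False]
      by (simp add: pairing_step[OF False] even_part_add odd_part_add even_part_smult odd_part_smult
          smult_add_right smult_diff_right algebra_simps)
  qed
qed

lemma pairing_add_right: "pairing a b x (y + y') = pairing a b x y + pairing a b x y'"
proof (induction a b x y arbitrary: y' rule: pairing.induct)
  case (1 a b x y)
  show ?case
  proof (cases "a = 0 \<and> b = 0")
    case True
    then show ?thesis by (simp add: pairing_base smult_add_right algebra_simps)
  next
    case False
    then show ?thesis using 1[OF False]
      by (simp add: pairing_step[OF False] even_part_add odd_part_add even_part_smult odd_part_smult
          smult_add_right smult_diff_right algebra_simps)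
  qed
qed

lemma pairing_smult_left: "pairing a b (smult c x) y = smult c (pairing a b x y)"
proof (induction a b x y rule: pairing.induct)
  case (1 a b x y)
  show ?case
  proof (cases "a = 0 \<and> b = 0")
    case True
    then show ?thesis by (simp add: pairing_base smult_add_right algebra_simps)
  next
    case False
    then show ?thesis using 1[OF False]
      by (simp add: pairing_step[OF False] even_part_add odd_part_add even_part_smult odd_part_smult
          smult_add_right smult_diff_right algebra_simps)
  qed
qed

lemma pairing_smult_right: "pairing a b x (smult c y) = smult c (pairing a b x y)"
proof (induction a b x y rule: pairing.induct)
  case (1 a b x y)
  show ?case
  proof (cases "a = 0 \<and> b = 0")
    case True
    then show ?thesis by (simp add: pairing_base smult_add_right algebra_simps)
  next
    case False
    then show ?thesis using 1[OF False]
      by (simp add: pairing_step[OF False] even_part_add odd_part_add even_part_smult odd_part_smult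
          smult_add_right smult_diff_right algebra_simps)
  qed
qed

lemma degree_even_part: "degree x \<le> a \<Longrightarrow> degree (even_part x) \<le> a div 2"
  by (intro degree_le) (auto simp: coeff_even_part intro!: coeff_eq_0)

lemma degree_odd_part: "degree x \<le> a \<Longrightarrow> degree (odd_part x) \<le> a div 2"
  by (intro degree_le) (auto simp: coeff_odd_part intro!: coeff_eq_0)

text \<open>
  The degree bounds \<open>a div 2\<close> and \<open>b div 2\<close> of the two parts would be too weak by one if \<open>b\<close> is even:
  the odd part of \<open>y\<close> then has degree below \<open>b div 2\<close>.
\<close>

lemma coeff_even_odd_mult_eq_0:
  assumes "degree x \<le> a" "degree y \<le> b" "(a + b + 1) div 2 \<le> i"
  shows "coeff (even_part x * odd_part y) i = 0"
  unfolding coeff_mult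
proof (rule sum.neutral, rule ballI)
  fix k assume "k \<in> {..i}"
  then have "a < 2 * k \<or> b < 2 * (i - k) + 1" using assms(3) by auto
  then show "coeff (even_part x) k * coeff (odd_part y) (i - k) = 0"
    using assms(1,2) by (auto simp: coeff_even_part coeff_odd_part intro!: coeff_eq_0)
qed

lemma coeff_pairing_eq_0:
  "degree x \<le> a \<Longrightarrow> degree y \<le> b \<Longrightarrow> pairing_dim a b \<le> i \<Longrightarrow> coeff (pairing a b x y) i = 0"
proof (induction a b x y arbitrary: i rule: pairing.induct)
  case (1 a b x y)
  show ?case
  proof (cases "a = 0 \<and> b = 0")
    case True
    then show ?thesis using "1.prems" by (auto simp: pairing_base pairing_dim.simps coeff_pCons split: nat.split)
  next
    case False
    let ?K = "(a + b + 1) div 2"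
    have r: "pairing_dim a b = ?K + pairing_dim (a div 2) (b div 2)" using False by (subst pairing_dim.simps) auto
    have K: "?K \<le> i" using "1.prems"(3) r by simp
    have "coeff (even_part x * odd_part y) i = 0"
      using "1.prems"(1,2) K by (rule coeff_even_odd_mult_eq_0)
    moreover have "coeff (odd_part x * even_part y) i = 0"
      using coeff_even_odd_mult_eq_0[OF "1.prems"(2,1)] K by (simp add: mult.commute add.commute)
    moreover have "coeff (pairing (a div 2) (b div 2) (even_part x) (even_part y)) (i - ?K) = 0"
      "coeff (pairing (a div 2) (b div 2) (odd_part x) (odd_part y)) (i - ?K) = 0"
      using "1.IH"(1)[OF False degree_even_part degree_even_part] "1.IH"(2)[OF False degree_odd_part degree_odd_part]
        "1.prems" r K le_diff_conv2[of ?K i "pairing_dim (a div 2) (b div 2)"] by auto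
    ultimately show ?thesis
      by (simp add: pairing_step[OF False] coeff_monom_mult)
  qed
qed

text \<open>
  A vanishing determinant of two vectors of polynomials means that both are multiples of one vector
  of polynomials, because the polynomials over a field have greatest common divisors.
\<close>

lemma proportional_polys:
  fixes p1 p2 q1 q2 :: "real poly"
  assumes "p1 \<noteq> 0 \<or> p2 \<noteq> 0" and "p1 * q2 = p2 * q1"
  obtains P Q G H where "p1 = P * G" "p2 = P * H" "q1 = Q * G" "q2 = Q * H"
proof -
  define P where "P = gcd p1 p2"
  have P: "P \<noteq> 0" using assms(1) by (simp add: P_def)
  obtain G H where GH: "p1 = P * G" "p2 = P * H" "coprime G H"
    using gcd_coprime_exists[of p1 p2] P unfolding P_def by (metis mult.commute)
  have eq: "G * q2 = H * q1" using assms(2) P unfolding GH by simp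
  show ?thesis
  proof (cases "G = 0")
    case True
    then have "is_unit H" using GH(3) by simp
    then have H: "H \<noteq> 0" and "H dvd q2" by auto
    then obtain Q where "q2 = H * Q" by (auto elim: dvdE)
    moreover have "q1 = 0" using eq True H by simp
    ultimately show ?thesis using GH True by (intro that[of P G H Q]) auto
  next
    case False
    have "G dvd H * q1" using eq by (metis dvd_triv_left)
    then have "G dvd q1" using GH(3) by (simp add: coprime_dvd_mult_right_iff)
    then obtain Q where Q: "q1 = G * Q" by (auto elim: dvdE)
    with eq False have "q2 = H * Q" by simp
    with Q GH show ?thesis by (intro that[of P G H Q]) auto
  qed
qed

lemma shifted_sum_eq_0D:
  fixes f g :: "real poly"
  assumes "f + monom 1 K * g = 0" "\<And>i. K \<le> i \<Longrightarrow> coeff f i = 0"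
  shows "f = 0" and "g = 0"
proof -
  have c: "coeff f i + (if i < K then 0 else coeff g (i - K)) = 0" for i
    using arg_cong[OF assms(1), of "\<lambda>h. coeff h i"] by (auto simp: coeff_monom_mult)
  show "f = 0"
    using c assms(2) by (intro poly_eqI) (metis add.right_neutral coeff_0 not_le)
  show "g = 0"
    using c[of "i + K" for i] assms(2) by (intro poly_eqI) (simp add: coeff_eq_0)
qed

lemma poly_zero_if_zero_on_negatives:
  fixes g :: "real poly"
  assumes "\<And>s. s < 0 \<Longrightarrow> poly g s = 0"
  shows "g = 0"
proof (rule ccontr)
  assume "g \<noteq> 0"
  then have "finite {s. poly g s = 0}" by (rule poly_roots_finite)
  moreover have "{..<0} \<subseteq> {s. poly g s = 0}" using assms by auto
  ultimately show False using infinite_Iio[of "0::real"] finite_subset by blast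
qed

lemma sum_list_eq_0_memberD:
  fixes f :: "'a \<Rightarrow> real"
  assumes "(\<Sum>x\<leftarrow>xs. f x) = 0" "\<And>x. 0 \<le> f x" "x \<in> set xs"
  shows "f x = 0"
proof -
  have "\<forall>y\<in>set (map f xs). y = 0"
    using sum_list_nonneg_eq_0_iff[of "map f xs"] assms(1,2) by auto
  then show ?thesis using assms(3) by simp
qed

lemma weighted_squares_eq_0:
  fixes x y t :: real
  assumes "x\<^sup>2 + t * y\<^sup>2 = 0" "t > 0"
  shows "x = 0 \<and> y = 0"
proof -
  have "0 \<le> t * y\<^sup>2" using assms(2) by simp
  then have "x\<^sup>2 = 0 \<and> t * y\<^sup>2 = 0"
    using assms(1) add_nonneg_eq_0_iff[of "x\<^sup>2" "t * y\<^sup>2"] by simp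
  then show ?thesis using assms(2) by simp
qed

text \<open>
  The polynomial \<open>g\<^sub>0\<^sup>2 - s g\<^sub>1\<^sup>2\<close> is the norm of \<open>g\<close> from \<open>\<real>[t]\<close> to \<open>\<real>[s]\<close>, where \<open>s = t\<^sup>2\<close>. At a negative
  \<open>s\<close> it is a sum of two squares with positive weights, so norms cannot cancel.
\<close>

lemma sum_list_norms_eq_0:
  fixes G :: "real poly list"
  assumes "(\<Sum>g\<leftarrow>G. even_part g * even_part g - [:0, 1:] * (odd_part g * odd_part g)) = 0"
  shows "\<forall>g\<in>set G. g = 0"
proof
  fix g assume g: "g \<in> set G"
  have *: "poly (even_part g) s = 0 \<and> poly (odd_part g) s = 0" if s: "s < 0" for s
  proof -
    let ?N = "\<lambda>g. (poly (even_part g) s)\<^sup>2 + (- s) * (poly (odd_part g) s)\<^sup>2"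
    have nn: "0 \<le> ?N h" for h
      using s by (intro add_nonneg_nonneg mult_nonneg_nonneg) auto
    have "(\<Sum>g\<leftarrow>G. ?N g) = poly (\<Sum>g\<leftarrow>G. even_part g * even_part g - [:0, 1:] * (odd_part g * odd_part g)) s"
      by (induction G) (simp_all add: power2_eq_square)
    also have "\<dots> = 0" using assms by simp
    finally have "?N g = 0"
      by (rule sum_list_eq_0_memberD[OF _ _ g]) (rule nn)
    then show ?thesis using s by (intro weighted_squares_eq_0[of _ "- s"]) simp_all
  qed
  show "g = 0"
    using * poly_zero_if_zero_on_negatives by (metis even_odd_eq_0D)
qed

text \<open>
  Multiplication by \<open>g\<close> acts on the pair of even and odd parts by the matrix with rows \<open>g\<^sub>0, X g\<^sub>1\<close> and
  \<open>g\<^sub>1, g\<^sub>0\<close>; the identity is the multiplicativity of the determinant.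
\<close>

lemma twisted_det_mult:
  fixes X :: "'a :: comm_ring_1"
  shows "(p0 * g0 + X * (p1 * g1)) * (q0 * g1 + q1 * g0) - (p0 * g1 + p1 * g0) * (q0 * g0 + X * (q1 * g1))
    = (g0 * g0 - X * (g1 * g1)) * (p0 * q1 - p1 * q0)"
  by (simp add: algebra_simps)

text \<open>
  The family \<open>G\<close> is needed for the induction: the recursive part of the pairing of \<open>p g\<close> and \<open>q g\<close> is a sum
  of two pairings, one for the even and one for the odd parts, so one summand becomes two.
\<close>

lemma pairing_definite:
  assumes "p \<noteq> 0" "q \<noteq> 0"
    and "\<And>g. g \<in> set G \<Longrightarrow> degree (p * g) \<le> a \<and> degree (q * g) \<le> b"
    and "(\<Sum>g\<leftarrow>G. pairing a b (p * g) (q * g)) = 0"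
  shows "\<forall>g\<in>set G. g = 0"
  using assms
proof (induction "a + b" arbitrary: a b p q G rule: less_induct)
  case less
  show ?case
  proof (cases "a = 0 \<and> b = 0")
    case True
    \<comment> \<open>Everything is constant, and the sum is \<open>p q\<close> times a sum of squares.\<close>
    have dg: "degree g = 0" "degree p = 0" "degree q = 0" if "g \<in> set G" "g \<noteq> 0" for g
      using less(4)[OF that(1)] less(2,3) that(2) True by (auto simp: degree_mult_eq)
    show ?thesis
    proof (rule ccontr)
      assume "\<not> ?thesis"
      then obtain g0 where g0: "g0 \<in> set G" "g0 \<noteq> 0" by blast
      have pq: "coeff p 0 \<noteq> 0" "coeff q 0 \<noteq> 0"
        using dg[OF g0] less(2,3) by (metis leading_coeff_0_iff)+
      have "pairing a b (p * g) (q * g) = [:coeff p 0 * coeff q 0 * (coeff g 0)\<^sup>2:]" for g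
        using True by (simp add: pairing_base coeff_mult power2_eq_square)
      with less(5) have "(\<Sum>g\<leftarrow>G. [:coeff p 0 * coeff q 0 * (coeff g 0)\<^sup>2:]) = 0" by simp
      also have "(\<Sum>g\<leftarrow>G. [:coeff p 0 * coeff q 0 * (coeff g 0)\<^sup>2:]) = [:coeff p 0 * coeff q 0 * (\<Sum>g\<leftarrow>G. (coeff g 0)\<^sup>2):]"
        by (induction G) (simp_all add: distrib_left)
      finally have "(\<Sum>g\<leftarrow>G. (coeff g 0)\<^sup>2) = 0" using pq by simp
      then have "coeff g0 0 = 0" using sum_list_eq_0_memberD[of "\<lambda>g. (coeff g 0)\<^sup>2" G g0] g0 by simp
      then show False using dg(1)[OF g0] g0(2) by (metis leading_coeff_0_iff)
    qed
  next
    case False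
    let ?K = "(a + b + 1) div 2"
    let ?phi = "pairing (a div 2) (b div 2)"
    let ?d = "\<lambda>x y. even_part x * odd_part y - odd_part x * even_part y"
    define D where "D = ?d p q"
    define top where "top = (\<Sum>g\<leftarrow>G. ?d (p * g) (q * g))"
    define rest where "rest = (\<Sum>g\<leftarrow>G. ?phi (even_part (p * g)) (even_part (q * g)) + ?phi (odd_part (p * g)) (odd_part (q * g)))"
    have "(\<Sum>g\<leftarrow>G. pairing a b (p * g) (q * g)) = top + monom 1 ?K * rest"
      unfolding top_def rest_def
      by (induction G) (simp_all add: pairing_step[OF False] algebra_simps)
    with less(5) have eq: "top + monom 1 ?K * rest = 0" by simp
    have topK: "coeff top i = 0" if "?K \<le> i" for i
    proof -
      have "coeff (?d (p * g) (q * g)) i = 0" if "g \<in> set G" for g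
        using coeff_even_odd_mult_eq_0[of "p * g" a "q * g" b i] coeff_even_odd_mult_eq_0[of "q * g" b "p * g" a i]
          less(4)[OF that] \<open>?K \<le> i\<close> by (simp add: mult.commute add.commute)
      then have "\<forall>g\<in>set G. coeff (?d (p * g) (q * g)) i = 0" by blast
      then show ?thesis unfolding top_def by (induction G) auto
    qed
    note top0 = shifted_sum_eq_0D(1)[OF eq topK] and rest0 = shifted_sum_eq_0D(2)[OF eq topK]
    \<comment> \<open>The determinants share the factor \<open>D\<close>, and the other factors are norms.\<close>
    have norm: "?d (p * g) (q * g) = (even_part g * even_part g - [:0, 1:] * (odd_part g * odd_part g)) * D" for g
      unfolding D_def even_part_mult odd_part_mult by (rule twisted_det_mult)
    have "top = (\<Sum>g\<leftarrow>G. even_part g * even_part g - [:0, 1:] * (odd_part g * odd_part g)) * D"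
      unfolding top_def norm by (rule sum_list_mult_const)
    then consider "(\<Sum>g\<leftarrow>G. even_part g * even_part g - [:0, 1:] * (odd_part g * odd_part g)) = 0" | "D = 0"
      using top0 by auto
    then show ?thesis
    proof cases
      case 1
      then show ?thesis by (rule sum_list_norms_eq_0)
    next
      case 2
      \<comment> \<open>Now \<open>p = P(t\<^sup>2) k\<close> and \<open>q = Q(t\<^sup>2) k\<close>, and \<open>P\<close>, \<open>Q\<close> can be factored out of the even and odd parts.\<close>
      have "even_part p \<noteq> 0 \<or> odd_part p \<noteq> 0" using less(2) even_odd_eq_0D by blast
      then obtain P Q k0 k1 where k: "even_part p = P * k0" "odd_part p = P * k1"
        "even_part q = Q * k0" "odd_part q = Q * k1"
        using 2 unfolding D_def by (elim proportional_polys[where ?q1.0 = "even_part q" and ?q2.0 = "odd_part q"]) auto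
      define k where "k = interleave k0 k1"
      have PQ: "P \<noteq> 0" "Q \<noteq> 0"
        using k less(2,3) even_odd_eq_0D[of p] even_odd_eq_0D[of q] by auto
      have k0: "k \<noteq> 0"
      proof
        assume "k = 0"
        then have "k0 = 0" "k1 = 0"
          using even_part_interleave[of k0 k1] odd_part_interleave[of k0 k1] unfolding k_def by auto
        then show False using k(1,2) less(2) even_odd_eq_0D[of p] by auto
      qed
      have eo: "even_part (p * g) = P * even_part (k * g)" "odd_part (p * g) = P * odd_part (k * g)"
        "even_part (q * g) = Q * even_part (k * g)" "odd_part (q * g) = Q * odd_part (k * g)" for g
        by (simp_all add: even_part_mult odd_part_mult k k_def even_part_interleave odd_part_interleave algebra_simps)
      define G' where "G' = concat (map (\<lambda>g. [even_part (k * g), odd_part (k * g)]) G)"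
      have "(\<Sum>g\<leftarrow>G'. ?phi (P * g) (Q * g)) = rest"
        unfolding rest_def G'_def by (induction G) (simp_all add: eo add.assoc)
      with rest0 have s0: "(\<Sum>g\<leftarrow>G'. ?phi (P * g) (Q * g)) = 0" by simp
      have "degree (P * h) \<le> a div 2 \<and> degree (Q * h) \<le> b div 2" if "h \<in> set G'" for h
      proof -
        from that obtain g where "g \<in> set G" "h = even_part (k * g) \<or> h = odd_part (k * g)"
          unfolding G'_def by auto
        then show ?thesis
          using less(4)[of g] degree_even_part degree_odd_part eo by metis
      qed
      moreover have "a div 2 + b div 2 < a + b" using False by auto
      ultimately have "\<forall>h\<in>set G'. h = 0"
        using less(1)[of "a div 2" "b div 2" P Q G'] PQ s0 by blast
      then have "\<forall>g\<in>set G. even_part (k * g) = 0 \<and> odd_part (k * g) = 0"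
        unfolding G'_def by auto
      then have "\<forall>g\<in>set G. k * g = 0" using even_odd_eq_0D by blast
      then show ?thesis using k0 by auto
    qed
  qed
qed

corollary pairing_nonsingular:
  assumes "degree x \<le> a" "degree y \<le> b" "pairing a b x y = 0"
  shows "x = 0 \<or> y = 0"
  using pairing_definite[of x y "[1]" a b] assms by auto

lemma pairing_dim_le: "pairing_dim a b \<le> a + b + 1"
proof (induction a b rule: pairing_dim.induct)
  case (1 a b)
  then show ?case by (subst pairing_dim.simps) auto
qed

text \<open>
  At a common digit \<open>1\<close> the determinant has \<open>a div 2 + b div 2 + 1\<close> coefficients although \<open>a + b\<close> exceeds
  \<open>2 (a div 2 + b div 2)\<close> by two; this saves one coordinate, and the other steps preserve the saving.
\<close>

lemma pairing_dim_le_if_common_bit: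
  "bit a j \<Longrightarrow> bit b j \<Longrightarrow> pairing_dim a b \<le> a + b"
proof (induction j arbitrary: a b)
  case 0
  then have "odd a" "odd b" by (simp_all add: bit_0)
  then show ?case using pairing_dim_le[of "a div 2" "b div 2"] by (subst pairing_dim.simps) (auto elim!: oddE)
next
  case (Suc j)
  then have "pairing_dim (a div 2) (b div 2) \<le> a div 2 + b div 2" by (simp add: bit_Suc)
  moreover have "\<not> (a = 0 \<and> b = 0)" using Suc.prems(1) by (metis bit_0_eq bot_apply bot_bool_def)
  ultimately show ?case by (subst pairing_dim.simps) auto
qed

section \<open>A large space of matrices without elements of rank one\<close>

text \<open>
  The zero matrix is included, as \<open>x\<close> or \<open>y\<close> may vanish.
\<close>

definition rank_one :: "real ^ 'm \<Rightarrow> real ^ 'n \<Rightarrow> real ^ 'n ^ 'm" where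
  "rank_one x y = (\<chi> i j. x $ i * y $ j)"

lemma rank_one_nth [simp]: "rank_one x y $ i $ j = x $ i * y $ j"
  by (simp add: rank_one_def)

lemma smult_sum_right: "smult c (\<Sum>i\<in>I. f i) = (\<Sum>i\<in>I. smult c (f i))"
  by (induction I rule: infinite_finite_induct) (simp_all add: smult_add_right)

lemma pairing_sum_left:
  "finite I \<Longrightarrow> pairing a b (\<Sum>i\<in>I. f i) y = (\<Sum>i\<in>I. pairing a b (f i) y)"
proof (induction I rule: finite_induct)
  case empty
  show ?case using pairing_smult_left[of a b 0 0 y] by simp
qed (simp add: pairing_add_left)

lemma pairing_sum_right:
  "finite I \<Longrightarrow> pairing a b x (\<Sum>i\<in>I. f i) = (\<Sum>i\<in>I. pairing a b x (f i))"
proof (induction I rule: finite_induct)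
  case empty
  show ?case using pairing_smult_right[of a b x 0 0] by simp
qed (simp add: pairing_add_right)

lemma dim_orthogonal_complement_ge:
  fixes F :: "'a :: euclidean_space set"
  assumes "finite F" "card F \<le> N"
  shows "DIM('a) \<le> dim {z. \<forall>f\<in>F. f \<bullet> z = 0} + N"
proof -
  have "orthogonal f z" if "\<forall>f\<in>F. f \<bullet> z = 0" "f \<in> span F" for f z
  proof -
    have "orthogonal z f"
      using that by (intro orthogonal_to_span[of f F z]) (auto simp: orthogonal_def inner_commute)
    then show ?thesis by (simp add: orthogonal_commute)
  qed
  then have eq: "{z. \<forall>f\<in>F. f \<bullet> z = 0} = {z \<in> UNIV. \<forall>f\<in>span F. orthogonal f z}"
    by (auto simp: orthogonal_def intro: span_base)
  have "dim {z \<in> UNIV. \<forall>f\<in>span F. orthogonal f z} + dim (span F) = dim (UNIV :: 'a set)"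
    by (rule dim_subspace_orthogonal_to_vectors) auto
  moreover have "dim (span F) \<le> N"
    using dim_le_card'[OF assms(1)] assms(2) by (simp add: dim_span)
  ultimately show ?thesis unfolding eq by (simp add: dim_UNIV)
qed

text \<open>
  The space is the common kernel of the \<open>a + b\<close> linear forms on matrices that take the matrix \<open>x y\<^sup>T\<close> to
  the coefficients of the pairing of the polynomials with coefficient vectors \<open>x\<close> and \<open>y\<close>.
\<close>

lemma exists_subspace_without_rank_one:
  assumes "CARD('m :: finite) = a + 1" "CARD('n :: finite) = b + 1" "bit a s" "bit b s"
  obtains V :: "(real ^ 'n ^ 'm) set" where
    "subspace V" "a * b + 1 \<le> dim V" "\<And>x y. rank_one x y \<in> V \<Longrightarrow> rank_one x y = 0"
proof -
  obtain f :: "'m \<Rightarrow> nat" where f: "bij_betw f UNIV {..a}"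
    using finite_same_card_bij[of "UNIV :: 'm set" "{..a}"] assms(1) by auto
  obtain g :: "'n \<Rightarrow> nat" where g: "bij_betw g UNIV {..b}"
    using finite_same_card_bij[of "UNIV :: 'n set" "{..b}"] assms(2) by auto
  have fa: "f i \<le> a" and gb: "g j \<le> b" for i j
    using f g unfolding bij_betw_def by auto
  have inj: "inj f" "inj g" using f g unfolding bij_betw_def by auto
  define X where "X = (\<lambda>x :: real ^ 'm. \<Sum>i\<in>UNIV. monom (x $ i) (f i))"
  define Y where "Y = (\<lambda>y :: real ^ 'n. \<Sum>j\<in>UNIV. monom (y $ j) (g j))"
  have cX: "coeff (X x) (f i) = x $ i" for x i
    unfolding X_def coeff_sum by (simp add: inj_eq[OF inj(1)] sum.delta)
  have cY: "coeff (Y y) (g j) = y $ j" for y j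
    unfolding Y_def coeff_sum by (simp add: inj_eq[OF inj(2)] sum.delta)
  have dX: "degree (X x) \<le> a" for x
    unfolding X_def by (intro degree_sum_le) (auto intro: order_trans[OF degree_monom_le fa])
  have dY: "degree (Y y) \<le> b" for y
    unfolding Y_def by (intro degree_sum_le) (auto intro: order_trans[OF degree_monom_le gb])
  define \<Phi> :: "nat \<Rightarrow> real ^ 'n ^ 'm" where
    "\<Phi> = (\<lambda>l. \<chi> i j. coeff (pairing a b (monom 1 (f i)) (monom 1 (g j))) l)"
  have \<Phi>: "\<Phi> l \<bullet> rank_one x y = coeff (pairing a b (X x) (Y y)) l" for l x y
  proof -
    have mx: "monom c k = smult c (monom 1 k)" for c :: real and k
      by (simp add: smult_monom)
    have "pairing a b (X x) (Y y) = (\<Sum>i\<in>UNIV. \<Sum>j\<in>UNIV. smult (x $ i * y $ j) (pairing a b (monom 1 (f i)) (monom 1 (g j))))"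
      unfolding X_def Y_def
      by (subst mx, subst (2) mx)
         (simp add: pairing_sum_left pairing_sum_right pairing_smult_left pairing_smult_right
          smult_sum_right mult.commute, rule sum.swap)
    then show ?thesis
      by (simp add: \<Phi>_def inner_vec_def coeff_sum mult.commute)
  qed
  define V where "V = {z. \<forall>h\<in>\<Phi> ` {..<a + b}. h \<bullet> z = 0}"
  have "subspace V"
    by (auto simp: V_def subspace_def inner_add_right)
  moreover have "a * b + 1 \<le> dim V"
  proof -
    have "DIM(real ^ 'n ^ 'm) \<le> dim V + (a + b)"
      unfolding V_def by (rule dim_orthogonal_complement_ge) (auto intro: order_trans[OF card_image_le])
    then show ?thesis using assms(1,2) by simp
  qed
  moreover have "rank_one x y = 0" if "rank_one x y \<in> V" for x y
  proof -
    have "coeff (pairing a b (X x) (Y y)) l = 0" for l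
    proof (cases "l < a + b")
      case True
      then show ?thesis using that \<Phi>[of l x y] by (simp add: V_def)
    next
      case False
      then show ?thesis
        using pairing_dim_le_if_common_bit[OF assms(3,4)] dX dY by (intro coeff_pairing_eq_0) auto
    qed
    then have "pairing a b (X x) (Y y) = 0" by (intro poly_eqI) simp
    then have "X x = 0 \<or> Y y = 0" by (rule pairing_nonsingular[OF dX dY])
    then have "x = 0 \<or> y = 0"
      using cX[of x] cY[of y] by (auto simp: vec_eq_iff)
    then show ?thesis by (auto simp: vec_eq_iff)
  qed
  ultimately show ?thesis by (rule that)
qed

section \<open>Tensors whose contractions avoid rank one\<close>

definition contract :: "('m::finite, 'n::finite, 'p::finite) tensor3 \<Rightarrow> real ^ 'p \<Rightarrow> real ^ 'n ^ 'm" where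
  "contract T d = (\<chi> i j. T $ i $ j \<bullet> d)"

lemma contract_outer3: "contract (outer3 a b c) d = rank_one ((c \<bullet> d) *\<^sub>R a) b"
  by (auto simp: contract_def outer3_def vec_eq_iff inner_vec_def sum_distrib_left sum_distrib_right mult_ac intro!: sum.cong)

lemma contract_sum: "finite I \<Longrightarrow> contract (\<Sum>i\<in>I. f i) d = (\<Sum>i\<in>I. contract (f i) d)"
  by (auto simp: contract_def vec_eq_iff inner_sum_left)

text \<open>
  As the zero matrix counts as \<open>rank_one\<close>, this contains that contraction is injective.
\<close>

definition avoids_rank_one :: "('m::finite, 'n::finite, 'p::finite) tensor3 \<Rightarrow> bool" where
  "avoids_rank_one T \<longleftrightarrow> (\<forall>d x y. contract T d = rank_one x y \<longrightarrow> d = 0)"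

lemma exists_orthogonal_to_few:
  fixes c :: "nat \<Rightarrow> real ^ 'p"
  assumes "r < CARD('p)"
  shows "\<exists>d. d \<noteq> 0 \<and> (\<forall>l<r. c l \<bullet> d = 0)"
proof -
  have "card (c ` {..<r}) \<le> r" by (metis card_image_le card_lessThan finite_lessThan)
  then have "dim (c ` {..<r}) < DIM(real ^ 'p)"
    using dim_le_card'[of "c ` {..<r}"] assms by simp
  then show ?thesis
    using orthogonal_to_subspace_exists[of "c ` {..<r}"]
    by (metis orthogonal_def inner_commute span_base imageI lessThan_iff)
qed

lemma rank_ge_if_contract_inj:
  fixes T :: "('m::finite, 'n::finite, 'p::finite) tensor3"
  assumes "\<And>d. contract T d = 0 \<Longrightarrow> d = 0" "sum_of_outer3 r T"
  shows "CARD('p) \<le> r"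
proof (rule ccontr)
  assume "\<not> CARD('p) \<le> r"
  obtain a :: "nat \<Rightarrow> real ^ 'm" and b :: "nat \<Rightarrow> real ^ 'n" and c :: "nat \<Rightarrow> real ^ 'p"
    where T: "T = (\<Sum>l<r. outer3 (a l) (b l) (c l))"
    using assms(2) unfolding sum_of_outer3_def by blast
  obtain d where d: "d \<noteq> 0" "\<And>l. l < r \<Longrightarrow> c l \<bullet> d = 0"
    using exists_orthogonal_to_few[of r c] \<open>\<not> CARD('p) \<le> r\<close> by auto
  have "contract T d = (\<Sum>l<r. rank_one ((c l \<bullet> d) *\<^sub>R a l) (b l))"
    unfolding T by (simp add: contract_sum contract_outer3)
  also have "\<dots> = 0" using d(2) by (intro sum.neutral) (auto simp: vec_eq_iff)
  finally show False using assms(1) d(1) by blast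
qed

text \<open>
  With at most \<open>p\<close> elementary tensors, all but the last of the third factors are orthogonal to some
  \<open>d \<noteq> 0\<close>, and only the last term survives in the contraction with \<open>d\<close>.
\<close>

lemma rank_gt_if_avoids_rank_one:
  fixes T :: "('m::finite, 'n::finite, 'p::finite) tensor3"
  assumes "avoids_rank_one T" "sum_of_outer3 r T"
  shows "CARD('p) < r"
proof (rule ccontr)
  assume "\<not> CARD('p) < r"
  then have r: "r \<le> CARD('p)" by simp
  obtain a :: "nat \<Rightarrow> real ^ 'm" and b :: "nat \<Rightarrow> real ^ 'n" and c :: "nat \<Rightarrow> real ^ 'p"
    where T: "T = (\<Sum>l<r. outer3 (a l) (b l) (c l))"
    using assms(2) unfolding sum_of_outer3_def by blast
  \<comment> \<open>For \<open>r = 0\<close> the truncated \<open>r - 1\<close> imposes no condition on \<open>d\<close>, and the contraction is zero.\<close>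
  have "r - 1 < CARD('p)" using r zero_less_card_finite[where 'a = 'p] by linarith
  then obtain d where d: "d \<noteq> 0" "\<And>l. l < r - 1 \<Longrightarrow> c l \<bullet> d = 0"
    using exists_orthogonal_to_few[of "r - 1" c] by auto
  have "contract T d = (\<Sum>l<r. rank_one ((c l \<bullet> d) *\<^sub>R a l) (b l))"
    unfolding T by (simp add: contract_sum contract_outer3)
  also have "\<dots> = (\<Sum>l<r. if l = r - 1 then rank_one ((c l \<bullet> d) *\<^sub>R a l) (b l) else 0)"
  proof (rule sum.cong)
    fix l assume "l \<in> {..<r}"
    then show "rank_one ((c l \<bullet> d) *\<^sub>R a l) (b l) = (if l = r - 1 then rank_one ((c l \<bullet> d) *\<^sub>R a l) (b l) else 0)"
      using d(2)[of l] by (auto simp: vec_eq_iff)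
  qed simp
  also have "\<exists>x y. \<dots> = rank_one x y"
  proof (cases "r = 0")
    case True
    then have "(\<Sum>l<r. if l = r - 1 then rank_one ((c l \<bullet> d) *\<^sub>R a l) (b l) else 0) = rank_one 0 0"
      by (simp add: vec_eq_iff)
    then show ?thesis by blast
  qed (auto simp: sum.delta)
  finally show False using assms(1) d(1) unfolding avoids_rank_one_def by blast
qed

lemma rank_one_iff_minors:
  fixes M :: "real ^ 'n ^ 'm"
  shows "(\<exists>x y. M = rank_one x y) \<longleftrightarrow> (\<forall>i j i' j'. M $ i $ j * M $ i' $ j' = M $ i $ j' * M $ i' $ j)"
proof
  assume minors: "\<forall>i j i' j'. M $ i $ j * M $ i' $ j' = M $ i $ j' * M $ i' $ j"
  show "\<exists>x y. M = rank_one x y"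
  proof (cases "M = 0")
    case True
    then have "M = rank_one 0 0" by (simp add: vec_eq_iff)
    then show ?thesis by blast
  next
    case False
    then obtain i0 j0 where nz: "M $ i0 $ j0 \<noteq> 0" by (auto simp: vec_eq_iff)
    have "M = rank_one (\<chi> i. M $ i $ j0 / M $ i0 $ j0) (M $ i0)"
      using nz minors by (auto simp: vec_eq_iff field_simps)
    then show ?thesis by blast
  qed
qed auto

lemma contract_scaleR: "contract T (k *\<^sub>R d) = k *\<^sub>R contract T d"
  by (simp add: contract_def vec_eq_iff)

lemma rank_one_scaleR: "k *\<^sub>R rank_one x y = rank_one (k *\<^sub>R x) y"
  by (simp add: vec_eq_iff)

text \<open>
  As \<open>K\<close> is a cone, \<open>d\<close> may be taken from the unit sphere, which is compact; hence the complement is a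
  projection of a closed set along a compact factor.
\<close>

lemma open_contract_avoids:
  fixes K :: "(real ^ 'n ^ 'm) set"
  assumes "closed K" and cone: "\<And>t M. M \<in> K \<Longrightarrow> t *\<^sub>R M \<in> K"
  shows "open {T :: ('m::finite, 'n::finite, 'p::finite) tensor3. \<forall>d. contract T d \<in> K \<longrightarrow> d = 0}"
proof -
  let ?c = "\<lambda>z :: (real ^ 'p) \<times> ('m, 'n, 'p) tensor3. contract (snd z) (fst z)"
  have "continuous_on UNIV ?c"
    unfolding contract_def by (intro continuous_intros)
  then have "closed (?c -` K)" by (intro closed_vimage assms(1))
  then have "closed {T. \<exists>d. d \<in> sphere 0 1 \<and> (d, T) \<in> ?c -` K}"
    by (intro closed_compact_projection) auto
  moreover have "{T :: ('m, 'n, 'p) tensor3. \<forall>d. contract T d \<in> K \<longrightarrow> d = 0}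
      = - {T. \<exists>d. d \<in> sphere 0 1 \<and> (d, T) \<in> ?c -` K}"
  proof -
    have "(\<exists>d. d \<noteq> 0 \<and> contract T d \<in> K) \<longleftrightarrow> (\<exists>d. d \<in> sphere 0 1 \<and> contract T d \<in> K)" (is "?L \<longleftrightarrow> ?R")
      for T :: "('m, 'n, 'p) tensor3"
    proof
      assume ?L
      then obtain d where d: "d \<noteq> 0" "contract T d \<in> K" by blast
      then have "contract T ((1 / norm d) *\<^sub>R d) \<in> K" by (simp only: contract_scaleR cone)
      moreover have "(1 / norm d) *\<^sub>R d \<in> sphere 0 1" using d(1) by simp
      ultimately show ?R by blast
    next
      assume ?R
      then obtain d where "d \<in> sphere 0 1" "contract T d \<in> K" by blast
      moreover from this have "d \<noteq> 0" by auto
      ultimately show ?L by blast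
    qed
    then show ?thesis by auto
  qed
  ultimately show ?thesis by (simp add: open_Compl)
qed

lemma open_avoids_rank_one: "open {T :: ('m::finite, 'n::finite, 'p::finite) tensor3. avoids_rank_one T}"
proof -
  let ?K = "{M :: real ^ 'n ^ 'm. \<exists>x y. M = rank_one x y}"
  have "closed ?K"
    unfolding rank_one_iff_minors
    by (intro closed_Collect_all closed_Collect_eq continuous_intros)
  moreover have "t *\<^sub>R M \<in> ?K" if "M \<in> ?K" for t M
    using that rank_one_scaleR by blast
  ultimately have "open {T :: ('m, 'n, 'p) tensor3. \<forall>d. contract T d \<in> ?K \<longrightarrow> d = 0}"
    by (rule open_contract_avoids)
  then show ?thesis by (simp add: avoids_rank_one_def)
qed

lemma exists_avoids_rank_one:
  assumes "CARD('m :: finite) = a + 1" "CARD('n :: finite) = b + 1" "CARD('p :: finite) = a * b + 1"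
    "bit a s" "bit b s"
  shows "\<exists>T :: ('m, 'n, 'p) tensor3. avoids_rank_one T"
proof -
  obtain V :: "(real ^ 'n ^ 'm) set" where V: "subspace V" "a * b + 1 \<le> dim V"
    "\<And>x y. rank_one x y \<in> V \<Longrightarrow> rank_one x y = 0"
    using exists_subspace_without_rank_one[OF assms(1,2,4,5)] by metis
  obtain B where B: "B \<subseteq> V" "independent B" "card B = dim V"
    using basis_exists[of V] by metis
  obtain B' where B': "B' \<subseteq> B" "card B' = a * b + 1" "finite B'"
    using obtain_subset_with_card_n[of "a * b + 1" B] V(2) B(3) by metis
  obtain h :: "'p \<Rightarrow> real ^ 'n ^ 'm" where h: "bij_betw h UNIV B'"
    using finite_same_card_bij[of "UNIV :: 'p set" B'] B' assms(3) by auto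
  have ind: "independent B'" using B(2) B'(1) independent_mono by blast
  define T :: "('m, 'n, 'p) tensor3" where "T = (\<chi> i j k. h k $ i $ j)"
  have c: "contract T d = (\<Sum>k\<in>UNIV. d $ k *\<^sub>R h k)" for d
    by (simp add: T_def contract_def vec_eq_iff inner_vec_def mult.commute)
  have "avoids_rank_one T"
    unfolding avoids_rank_one_def
  proof (intro allI impI)
    fix d x y assume eq: "contract T d = rank_one x y"
    have hV: "h k \<in> V" for k using h B(1) B'(1) unfolding bij_betw_def by auto
    have "contract T d \<in> V"
      unfolding c using hV by (intro subspace_sum[OF V(1)] subspace_scale[OF V(1)])
    then have "contract T d = 0" using V(3) eq by simp
    then have "(\<Sum>k\<in>UNIV. d $ k *\<^sub>R h k) = 0" by (simp add: c)
    moreover have "(\<Sum>k\<in>UNIV. d $ k *\<^sub>R h k) = (\<Sum>v\<in>B'. d $ (inv h v) *\<^sub>R v)"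
      using h by (subst sum.reindex_bij_betw[OF h, symmetric]) (auto simp: bij_betw_def inv_f_f)
    ultimately have "\<forall>v\<in>B'. d $ (inv h v) = 0"
      using ind B'(3) by (auto simp: independent_explicit)
    then show "d = 0" using h by (auto simp: vec_eq_iff bij_betw_def inv_f_f)
  qed
  then show ?thesis by blast
qed

section \<open>Bilinear forms on a curve\<close>

text \<open>
  Polynomials of degree below \<open>a\<close>, shifted by the multiples of \<open>a\<close>, do not overlap.
\<close>

lemma coeff_sum_blocks:
  fixes C :: "nat \<Rightarrow> real poly"
  assumes "\<And>j i. a \<le> i \<Longrightarrow> coeff (C j) i = 0" "i < a" "j \<le> b"
  shows "coeff (\<Sum>j\<le>b. monom 1 (a * j) * C j) (a * j + i) = coeff (C j) i"
proof -
  have "coeff (monom 1 (a * j') * C j') (a * j + i) = (if j' = j then coeff (C j) i else 0)" for j'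
  proof (cases "j' = j")
    case False
    then consider "j' < j" | "j < j'" by linarith
    then show ?thesis
    proof cases
      case 1
      then have "a * j' + a \<le> a * j" using mult_le_mono2[of "Suc j'" j a] by simp
      then show ?thesis using False assms(1) by (auto simp: coeff_monom_mult)
    next
      case 2
      then have "a * j + a \<le> a * j'" using mult_le_mono2[of "Suc j" j' a] by simp
      then show ?thesis using False assms(2) by (auto simp: coeff_monom_mult)
    qed
  qed (simp add: coeff_monom_mult)
  then show ?thesis using assms(3) by (simp add: coeff_sum sum.delta)
qed

lemma degree_sum_blocks:
  fixes C :: "nat \<Rightarrow> real poly"
  assumes "\<And>j i. a \<le> i \<Longrightarrow> coeff (C j) i = 0" "0 < a"
  shows "degree (\<Sum>j\<le>b. monom 1 (a * j) * C j) < a * (b + 1)"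
proof -
  have "coeff (monom 1 (a * j) * C j) n = 0" if "j \<le> b" "a * (b + 1) \<le> n" for j n
  proof -
    have "a * j + a \<le> n"
      using mult_le_mono2[OF that(1), of a] that(2) unfolding distrib_left mult_1_right by linarith
    then have "a \<le> n - a * j" by linarith
    then show ?thesis using assms(1) by (simp add: coeff_monom_mult)
  qed
  then have "coeff (\<Sum>j\<le>b. monom 1 (a * j) * C j) n = 0" if "a * (b + 1) \<le> n" for n
    using that by (simp add: coeff_sum)
  then have "degree (\<Sum>j\<le>b. monom 1 (a * j) * C j) \<le> a * (b + 1) - 1"
    by (intro degree_le) auto
  moreover have "0 < a * (b + 1)" using assms(2) by simp
  ultimately show ?thesis by linarith
qed

text \<open>
  The rank-one matrices used below come from the points \<open>(x, x\<^sup>a)\<close> of a plane curve. A matrix \<open>B\<close> is a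
  polynomial \<open>\<beta>(x, y)\<close> of degree at most \<open>a\<close> in \<open>x\<close> and \<open>b\<close> in \<open>y\<close>. If it vanishes on the two coordinate
  lines through the point with index \<open>k\<close>, it is divisible by \<open>(x - x\<^sub>k) (y - y\<^sub>k)\<close>, and the quotient has
  degrees below \<open>a\<close> and \<open>b\<close>. Restricted to the curve, the monomials \<open>x\<^sup>i y\<^sup>j\<close> of the quotient become the powers
  \<open>x\<^bsup>i + a j\<^esup>\<close> with distinct exponents below \<open>a b\<close>. So the quotient is zero if \<open>\<beta>\<close> vanishes at the other
  \<open>a b\<close> points. The values \<open>x\<^sub>l\<close> are nonnegative so that the values \<open>x\<^sub>l\<^sup>a\<close> are distinct as well.
\<close>

lemma bilinear_form_eq_0_if_singular:
  fixes B :: "nat \<Rightarrow> nat \<Rightarrow> real" and x :: "'i \<Rightarrow> real"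
  assumes I: "finite I" "card I = a * b + 1" "k \<in> I" and a: "0 < a"
    and x: "inj_on x I" "\<And>l. l \<in> I \<Longrightarrow> 0 \<le> x l"
    and left: "\<And>j. j \<le> b \<Longrightarrow> (\<Sum>i\<le>a. B i j * x k ^ i) = 0"
    and right: "\<And>i. i \<le> a \<Longrightarrow> (\<Sum>j\<le>b. B i j * (x k ^ a) ^ j) = 0"
    and zero: "\<And>l. l \<in> I \<Longrightarrow> (\<Sum>i\<le>a. \<Sum>j\<le>b. B i j * x l ^ i * (x l ^ a) ^ j) = 0"
    and ij: "i \<le> a" "j \<le> b"
  shows "B i j = 0"
proof -
  define P where "P = (\<lambda>j. \<Sum>i\<le>a. if j \<le> b then monom (B i j) i else 0)"
  have poly_P: "poly (P j) t = (\<Sum>i\<le>a. B i j * t ^ i)" if "j \<le> b" for j t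
    using that by (simp add: P_def poly_sum poly_monom)
  have coeff_P: "coeff (P j) i = (if i \<le> a \<and> j \<le> b then B i j else 0)" for i j
    unfolding P_def coeff_sum
    by (cases "j \<le> b"; cases "i \<le> a") (auto simp: sum.delta intro!: sum.neutral)
  \<comment> \<open>\<open>P j\<close> is the coefficient of \<open>y\<^sup>j\<close> in \<open>\<beta>\<close>; vanishing on the line \<open>x = x\<^sub>k\<close> allows division by \<open>x - x\<^sub>k\<close>.\<close>
  have "\<exists>C. P j = [:- x k, 1:] * C" for j
  proof -
    have "poly (P j) (x k) = 0"
    proof (cases "j \<le> b")
      case True
      then show ?thesis using left by (simp add: poly_P)
    qed (simp add: P_def)
    then show ?thesis by (simp add: poly_eq_0_iff_dvd dvd_def)
  qed
  then obtain C where C: "\<And>j. P j = [:- x k, 1:] * C j" by metis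
  have coeff_C: "coeff (C j) i = 0" if "a \<le> i" for i j
  proof (cases "C j = 0")
    case False
    have "degree (P j) \<le> a" by (intro degree_le) (simp add: coeff_P)
    moreover have "degree (P j) = Suc (degree (C j))"
      unfolding C[of j] using False by (subst degree_mult_eq) auto
    ultimately show ?thesis using that by (intro coeff_eq_0) auto
  qed simp
  \<comment> \<open>\<open>R\<close> is the restriction of \<open>\<beta>(x, y) / (x - x\<^sub>k)\<close> to the curve; division by \<open>y - y\<^sub>k\<close> becomes division by \<open>x\<^sup>a - x\<^sub>k\<^sup>a\<close>.\<close>
  define R where "R = (\<Sum>j\<le>b. monom 1 (a * j) * C j)"
  have C0: "(\<Sum>j\<le>b. [:x k ^ a:] ^ j * C j) = 0"
  proof -
    have pc: "[:x k ^ a:] ^ j = [:(x k ^ a) ^ j:]" for j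
      by (induction j) (simp_all add: one_pCons mult.commute)
    have "[:- x k, 1:] * (\<Sum>j\<le>b. [:x k ^ a:] ^ j * C j) = (\<Sum>j\<le>b. smult ((x k ^ a) ^ j) (P j))"
      unfolding sum_distrib_left by (intro sum.cong) (simp_all only: C pc, simp_all add: algebra_simps)
    also have "\<dots> = 0"
    proof (rule poly_eqI)
      fix i
      show "coeff (\<Sum>j\<le>b. smult ((x k ^ a) ^ j) (P j)) i = coeff 0 i"
        using right[of i] by (cases "i \<le> a") (simp_all add: coeff_sum coeff_P mult.commute)
    qed
    finally show ?thesis by (metis mult_eq_0_iff pCons_eq_0_iff zero_neq_one)
  qed
  have "R = (\<Sum>j\<le>b. (monom 1 a ^ j - [:x k ^ a:] ^ j) * C j)"
    using C0 by (simp add: R_def left_diff_distrib sum_subtractf monom_power)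
  moreover have "monom 1 a - [:x k ^ a:] dvd \<dots>"
    by (intro dvd_sum dvd_mult2) (metis dvd_triv_left power_diff_sumr2)
  ultimately obtain Q where Q: "R = (monom 1 a - [:x k ^ a:]) * Q" by (auto elim: dvdE)
  have degU: "degree (monom 1 a - [:x k ^ a:]) = a"
    unfolding diff_conv_add_uminus using a
    by (subst degree_add_eq_left) (simp_all add: degree_monom_eq)
  have root: "poly Q (x l) = 0" if l: "l \<in> I - {k}" for l
  proof -
    have ne: "x l \<noteq> x k" using l I(3) x(1) by (auto dest: inj_onD)
    have "(x l - x k) * poly R (x l) = (\<Sum>j\<le>b. poly ([:- x k, 1:] * C j) (x l) * (x l ^ a) ^ j)"
      unfolding R_def poly_sum sum_distrib_left poly_mult poly_monom power_mult
      by (intro sum.cong refl) (simp add: algebra_simps)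
    also have "\<dots> = (\<Sum>j\<le>b. \<Sum>i\<le>a. B i j * x l ^ i * (x l ^ a) ^ j)"
      unfolding C[symmetric] by (simp add: poly_P sum_distrib_right)
    also have "\<dots> = 0"
      using zero[of l] l by (subst sum.swap) simp
    finally have "poly R (x l) = 0" using ne by simp
    moreover have "x l ^ a \<noteq> x k ^ a"
      using ne x(2) l I(3) a by (simp add: power_eq_iff_eq_base)
    ultimately show ?thesis by (simp add: Q poly_monom)
  qed
  have "Q = 0"
  proof (rule ccontr)
    assume "Q \<noteq> 0"
    have "degree R < a * (b + 1)"
      unfolding R_def using coeff_C a by (intro degree_sum_blocks)
    moreover have "degree R = a + degree Q"
      unfolding Q using \<open>Q \<noteq> 0\<close> degU a by (subst degree_mult_eq) auto
    ultimately have "degree Q < a * b" by simp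
    moreover have "card (x ` (I - {k})) = a * b"
      using I x(1) by (subst card_image) (auto intro: inj_on_subset)
    moreover have "card (x ` (I - {k})) \<le> card {t. poly Q t = 0}"
      using root \<open>Q \<noteq> 0\<close> by (intro card_mono poly_roots_finite) auto
    ultimately show False using card_poly_roots_bound[OF \<open>Q \<noteq> 0\<close>] by simp
  qed
  then have "R = 0" using Q by simp
  then have "coeff (C j) i = 0" for i
    using coeff_sum_blocks[of a C i j b] coeff_C ij(2) unfolding R_def by (cases "i < a") auto
  then have "C j = 0" by (intro poly_eqI) simp
  then have "P j = 0" using C by simp
  then show ?thesis using coeff_P[of j i] ij by simp
qed

text \<open>
  This is the invertibility of the Vandermonde matrix, proved by testing with the polynomial that
  vanishes at all points except the one with index \<open>k\<close>.
\<close>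

lemma moments_eq_0:
  fixes d x :: "'i \<Rightarrow> real"
  assumes I: "finite I" "card I = N + 1" "inj_on x I"
    and m: "\<And>e. e \<le> N \<Longrightarrow> (\<Sum>l\<in>I. d l * x l ^ e) = 0" and k: "k \<in> I"
  shows "d k = 0"
proof -
  define P where "P = (\<Prod>l\<in>I - {k}. [:- x l, 1:])"
  have "degree P \<le> N"
    using degree_prod_sum_le[of "I - {k}" "\<lambda>l. [:- x l, 1:]"] I k by (simp add: P_def)
  have "poly P t = (\<Sum>e\<le>N. coeff P e * t ^ e)" for t
    unfolding poly_altdef using \<open>degree P \<le> N\<close>
    by (intro sum.mono_neutral_left) (auto simp: coeff_eq_0)
  then have "(\<Sum>l\<in>I. d l * poly P (x l)) = (\<Sum>e\<le>N. coeff P e * (\<Sum>l\<in>I. d l * x l ^ e))"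
    by (simp add: sum_distrib_left sum.swap[of _ I] mult_ac)
  also have "\<dots> = 0" using m by simp
  also have "(\<Sum>l\<in>I. d l * poly P (x l)) = (\<Sum>l\<in>I. if l = k then d k * poly P (x k) else 0)"
    using I(1) by (intro sum.cong) (auto simp: P_def poly_prod)
  also have "\<dots> = d k * poly P (x k)" using I(1) k by simp
  finally have "d k * poly P (x k) = 0" .
  moreover have "poly P (x k) \<noteq> 0"
    using I(1,3) k by (auto simp: P_def poly_prod dest: inj_onD)
  ultimately show ?thesis by simp
qed

section \<open>Submersive points of the sum of elementary tensors\<close>

text \<open>
  The number of terms is fixed to the third dimension and the terms are indexed by its type. This
  makes the factors a Euclidean space, on which the open mapping theorem for submersions applies.
\<close>

type_synonym ('m, 'n, 'p) factors = "((real ^ 'm) ^ 'p) \<times> ((real ^ 'n) ^ 'p) \<times> ((real ^ 'p) ^ 'p)"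

definition outer_sum :: "('m::finite, 'n::finite, 'p::finite) factors \<Rightarrow> ('m, 'n, 'p) tensor3" where
  "outer_sum z = (\<Sum>l\<in>UNIV. outer3 (fst z $ l) (fst (snd z) $ l) (snd (snd z) $ l))"

definition outer_sum_deriv ::
    "('m::finite, 'n::finite, 'p::finite) factors \<Rightarrow> ('m, 'n, 'p) factors \<Rightarrow> ('m, 'n, 'p) tensor3" where
  "outer_sum_deriv z w =
    (\<Sum>l\<in>UNIV. outer3 (fst w $ l) (fst (snd z) $ l) (snd (snd z) $ l)
      + outer3 (fst z $ l) (fst (snd w) $ l) (snd (snd z) $ l)
      + outer3 (fst z $ l) (fst (snd z) $ l) (snd (snd w) $ l))"

lemma has_derivative_outer_sum:
  fixes z :: "('m::finite, 'n::finite, 'p::finite) factors"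
  shows "(outer_sum has_derivative outer_sum_deriv z) (at z)"
proof -
  let ?op = "\<lambda>(x :: real ^ 'm) (M :: real ^ 'p ^ 'n). (\<chi> i. x $ i *\<^sub>R M) :: real ^ 'p ^ 'n ^ 'm"
  have b1: "bounded_bilinear (rank_one :: real ^ 'n \<Rightarrow> real ^ 'p \<Rightarrow> _)"
    by (subst bilinear_conv_bounded_bilinear[symmetric])
       (auto simp: bilinear_def vec_eq_iff algebra_simps intro!: linearI)
  have b2: "bounded_bilinear ?op"
    by (subst bilinear_conv_bounded_bilinear[symmetric])
       (auto simp: bilinear_def vec_eq_iff algebra_simps intro!: linearI)
  have o: "outer3 x y w = ?op x (rank_one y w)" for x :: "real ^ 'm" and y :: "real ^ 'n" and w :: "real ^ 'p"
    by (simp add: outer3_def vec_eq_iff)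
  have l: "((\<lambda>z. fst z $ l) has_derivative (\<lambda>w. fst w $ l)) (at z)"
    "((\<lambda>z. fst (snd z) $ l) has_derivative (\<lambda>w. fst (snd w) $ l)) (at z)"
    "((\<lambda>z. snd (snd z) $ l) has_derivative (\<lambda>w. snd (snd w) $ l)) (at z)"
    for l :: 'p and z :: "('m, 'n, 'p) factors"
    by (auto intro!: bounded_linear_imp_has_derivative bounded_linear_intros
        bounded_linear_compose[OF bounded_linear_vec_nth])
  have "((\<lambda>z. outer3 (fst z $ l) (fst (snd z) $ l) (snd (snd z) $ l)) has_derivative
    (\<lambda>w. outer3 (fst w $ l) (fst (snd z) $ l) (snd (snd z) $ l)
      + outer3 (fst z $ l) (fst (snd w) $ l) (snd (snd z) $ l)
      + outer3 (fst z $ l) (fst (snd z) $ l) (snd (snd w) $ l))) (at z)" for l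
    unfolding o
    by (rule has_derivative_eq_rhs[OF bounded_bilinear.FDERIV[OF b2 l(1) bounded_bilinear.FDERIV[OF b1 l(2) l(3)]]])
       (auto simp: vec_eq_iff algebra_simps)
  then show ?thesis
    unfolding outer_sum_def[abs_def] outer_sum_deriv_def[abs_def]
    by (intro has_derivative_sum)
qed

lemma linear_outer_sum_deriv: "linear (outer_sum_deriv z)"
  using has_derivative_outer_sum by (rule has_derivative_linear)

lemma outer_sum_interior:
  fixes z :: "('m::finite, 'n::finite, 'p::finite) factors"
  assumes "surj (outer_sum_deriv z)"
  shows "outer_sum z \<in> interior (range outer_sum)"
proof -
  obtain g where g: "linear g" "outer_sum_deriv z \<circ> g = id"
    using linear_surjective_right_inverse[OF linear_outer_sum_deriv assms] by blast
  have "continuous_on UNIV (outer_sum :: ('m, 'n, 'p) factors \<Rightarrow> _)"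
    by (intro continuous_at_imp_continuous_on ballI has_derivative_continuous[OF has_derivative_outer_sum])
  then show ?thesis
    using g has_derivative_outer_sum
    by (intro sussmann_open_mapping[of UNIV outer_sum z "outer_sum_deriv z" g UNIV])
       (simp_all add: linear_conv_bounded_linear)
qed

lemma det_poly:
  fixes A :: "real \<Rightarrow> real ^ 'k ^ 'k"
  assumes "\<And>i j. \<exists>P. \<forall>s. A s $ i $ j = poly P s"
  shows "\<exists>P. \<forall>s. det (A s) = poly P s"
proof -
  obtain P where P: "\<And>i j s. A s $ i $ j = poly (P i j) s" using assms by metis
  show ?thesis
    by (rule exI[of _ "\<Sum>\<pi> | \<pi> permutes UNIV. smult (of_int (sign \<pi>)) (\<Prod>i\<in>UNIV. P i (\<pi> i))"])
       (simp add: det_def P poly_sum poly_prod)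
qed

text \<open>
  Along a line the derivative is polynomial in the parameter \<open>s\<close>. Composed with a right inverse of the
  derivative at \<open>s = 1\<close>, it becomes a square matrix whose determinant is a polynomial in \<open>s\<close> that is not
  zero, and which therefore does not vanish for suitable arbitrarily small \<open>s\<close>.
\<close>

lemma surj_outer_sum_deriv_dense:
  fixes z0 w :: "('m::finite, 'n::finite, 'p::finite) factors"
  assumes "surj (outer_sum_deriv (z0 + w))" "0 < \<epsilon>"
  shows "\<exists>s. 0 < s \<and> s < \<epsilon> \<and> surj (outer_sum_deriv (z0 + s *\<^sub>R w))"
proof -
  obtain g where g: "linear g" "outer_sum_deriv (z0 + w) \<circ> g = id"
    using linear_surjective_right_inverse[OF linear_outer_sum_deriv assms(1)] by blast
  define unvec :: "real ^ ('m \<times> 'n \<times> 'p) \<Rightarrow> ('m, 'n, 'p) tensor3" where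
    "unvec = (\<lambda>v. \<chi> i j k. v $ (i, j, k))"
  define tovec :: "('m, 'n, 'p) tensor3 \<Rightarrow> real ^ ('m \<times> 'n \<times> 'p)" where
    "tovec = (\<lambda>T. \<chi> q. T $ fst q $ fst (snd q) $ snd (snd q))"
  have lin: "linear unvec" "linear tovec"
    by (auto simp: unvec_def tovec_def vec_eq_iff intro!: linearI)
  have inv: "unvec (tovec T) = T" "tovec (unvec v) = v" for T v
    by (simp_all add: unvec_def tovec_def vec_eq_iff)
  define L where "L = (\<lambda>s v. tovec (outer_sum_deriv (z0 + s *\<^sub>R w) (g (unvec v))))"
  have linL: "linear (L s)" for s
    unfolding L_def
    using linear_compose[OF linear_compose[OF linear_compose[OF lin(1) g(1)] linear_outer_sum_deriv] lin(2)]
    by (simp add: o_def)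
  have "\<exists>P. \<forall>s. matrix (L s) $ q $ q' = poly P s" for q q'
  proof -
    define h where "h = g (unvec (axis q' 1))"
    define i j k where "i = fst q" and "j = fst (snd q)" and "k = snd (snd q)"
    let ?a = "\<lambda>l. [:fst z0 $ l $ i, fst w $ l $ i:]"
    let ?b = "\<lambda>l. [:fst (snd z0) $ l $ j, fst (snd w) $ l $ j:]"
    let ?c = "\<lambda>l. [:snd (snd z0) $ l $ k, snd (snd w) $ l $ k:]"
    have "matrix (L s) $ q $ q' = outer_sum_deriv (z0 + s *\<^sub>R w) h $ i $ j $ k" for s
      by (simp add: matrix_def L_def h_def tovec_def i_def j_def k_def)
    also have "outer_sum_deriv (z0 + s *\<^sub>R w) h $ i $ j $ k
      = poly (\<Sum>l\<in>UNIV. [:fst h $ l $ i:] * ?b l * ?c l + ?a l * [:fst (snd h) $ l $ j:] * ?c l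
          + ?a l * ?b l * [:snd (snd h) $ l $ k:]) s" for s
      unfolding outer_sum_deriv_def poly_sum sum_component
      by (intro sum.cong) (simp_all add: outer3_def algebra_simps)
    finally show ?thesis by blast
  qed
  then obtain P where P: "\<And>s. det (matrix (L s)) = poly P s"
    using det_poly[of "\<lambda>s. matrix (L s)"] by metis
  have "L 1 = id"
    using g(2) by (auto simp: L_def fun_eq_iff inv o_def)
  then have "poly P 1 = 1" using P[of 1] by (simp add: matrix_id_mat_1)
  then have "P \<noteq> 0" by auto
  then have "finite {s. poly P s = 0}" by (rule poly_roots_finite)
  moreover have "infinite {0<..<\<epsilon>}" using assms(2) by (simp add: infinite_Ioo)
  ultimately have "\<not> {0<..<\<epsilon>} \<subseteq> {s. poly P s = 0}"
    using finite_subset by blast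
  then obtain s where "s \<in> {0<..<\<epsilon>}" "poly P s \<noteq> 0" by blast
  then have s: "0 < s" "s < \<epsilon>" "poly P s \<noteq> 0" by simp_all
  have "invertible (matrix (L s))" using s(3) P by (simp add: invertible_det_nz)
  then have "surj ((*v) (matrix (L s)))"
    using invertible_right_inverse[of "matrix (L s)"] matrix_right_invertible_surjective[of "matrix (L s)"]
    by simp
  moreover have "(*v) (matrix (L s)) = L s"
    by (rule ext) (simp add: matrix_works linL)
  ultimately have "surj (L s)" by simp
  have "surj (outer_sum_deriv (z0 + s *\<^sub>R w))"
    unfolding surj_def
  proof
    fix T
    obtain v where "tovec T = L s v" using \<open>surj (L s)\<close> by (metis surjD)
    then have "unvec (tovec T) = unvec (L s v)" by simp
    then have "T = outer_sum_deriv (z0 + s *\<^sub>R w) (g (unvec v))" by (simp add: L_def inv)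
    then show "\<exists>u. T = outer_sum_deriv (z0 + s *\<^sub>R w) u" by blast
  qed
  with s show ?thesis by blast
qed

lemma surj_if_orthogonal_complement_trivial:
  fixes f :: "'a::euclidean_space \<Rightarrow> 'b::euclidean_space"
  assumes "linear f" "\<And>\<beta>. (\<And>w. f w \<bullet> \<beta> = 0) \<Longrightarrow> \<beta> = 0"
  shows "surj f"
proof (rule ccontr)
  assume "\<not> surj f"
  moreover have "span (range f) = range f"
    using assms(1) by (simp add: span_eq_iff linear_subspace_image)
  ultimately obtain \<beta> where "\<beta> \<noteq> 0" "\<forall>x\<in>span (range f). \<beta> \<bullet> x = 0"
    using span_not_UNIV_orthogonal[of "range f"] by metis
  then show False using assms(2)[of \<beta>] span_base[of _ "range f"] by (auto simp: inner_commute)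
qed

text \<open>
  If the third factors are the standard basis, surjectivity of the derivative can be tested slice by
  slice. A matrix orthogonal to the slice with index \<open>k\<close> of the image is annihilated by the vectors \<open>u k\<close> and
  \<open>v k\<close> and orthogonal to all matrices \<open>u l (v l)\<^sup>T\<close>. The two kinds of conditions are \<open>m + n - 1\<close> and
  \<open>p - 1 = a b\<close> in number, which together is just \<open>m n\<close>.
\<close>

lemma exists_submersive_factors:
  assumes "CARD('m :: finite) = a + 1" "CARD('n :: finite) = b + 1" "CARD('p :: finite) = a * b + 1"
    "0 < a"
  shows "\<exists>z :: ('m, 'n, 'p) factors. surj (outer_sum_deriv z) \<and> (\<forall>d. contract (outer_sum z) d = 0 \<longrightarrow> d = 0)"
proof -
  obtain f :: "'m \<Rightarrow> nat" where f: "bij_betw f UNIV {..a}"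
    using finite_same_card_bij[of "UNIV :: 'm set" "{..a}"] assms(1) by auto
  obtain g :: "'n \<Rightarrow> nat" where g: "bij_betw g UNIV {..b}"
    using finite_same_card_bij[of "UNIV :: 'n set" "{..b}"] assms(2) by auto
  obtain h :: "'p \<Rightarrow> nat" where h: "bij_betw h UNIV {..a * b}"
    using finite_same_card_bij[of "UNIV :: 'p set" "{..a * b}"] assms(3) by auto
  define x where "x = (\<lambda>l. real (h l))"
  have x: "inj x" "\<And>l. 0 \<le> x l"
    using h by (auto simp: x_def bij_betw_def inj_on_def)
  define u :: "'p \<Rightarrow> real ^ 'm" where "u = (\<lambda>l. \<chi> i. x l ^ f i)"
  define v :: "'p \<Rightarrow> real ^ 'n" where "v = (\<lambda>l. \<chi> j. (x l ^ a) ^ g j)"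
  define z :: "('m, 'n, 'p) factors" where "z = (\<chi> l. u l, \<chi> l. v l, \<chi> l. axis l 1)"
  have inv: "inv f (f i) = i" "inv g (g j) = j" for i j
    using f g by (auto simp: bij_betw_def inv_f_f)
  have "surj (outer_sum_deriv z)"
  proof (rule surj_if_orthogonal_complement_trivial[OF linear_outer_sum_deriv])
    fix \<beta> :: "('m, 'n, 'p) tensor3"
    assume \<beta>: "outer_sum_deriv z w \<bullet> \<beta> = 0" for w
    have inner: "outer3 r s (axis k 1) \<bullet> \<beta> = (\<Sum>i\<in>UNIV. \<Sum>j\<in>UNIV. r $ i * s $ j * \<beta> $ i $ j $ k)" for r s k
    proof -
      have "(\<Sum>k'\<in>UNIV. r $ i * s $ j * axis k 1 $ k' * \<beta> $ i $ j $ k')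
          = (\<Sum>k'\<in>UNIV. if k' = k then r $ i * s $ j * \<beta> $ i $ j $ k else 0)" for i j
        by (intro sum.cong) (auto simp: axis_def)
      then show ?thesis by (simp add: outer3_def inner_vec_def)
    qed
    have zero: "outer3 0 s t = (0 :: ('m, 'n, 'p) tensor3)" "outer3 r 0 t = (0 :: ('m, 'n, 'p) tensor3)"
      "outer3 r s 0 = (0 :: ('m, 'n, 'p) tensor3)" for r s t
      by (simp_all add: outer3_def vec_eq_iff)
    have ax: "(axis l r :: 'q::zero ^ 'p) $ l' = (if l' = l then r else 0)" for l l' :: 'p and r :: "'q::zero"
      by (simp add: axis_def)
    have right: "(\<Sum>j\<in>UNIV. v k $ j * \<beta> $ i $ j $ k) = 0" for i k
    proof -
      have "outer_sum_deriv z (axis k (axis i 1), 0, 0) = outer3 (axis i 1) (v k) (axis k 1)"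
        unfolding outer_sum_deriv_def z_def
        by (simp add: zero ax if_distrib[of "\<lambda>r. outer3 r _ _"] cong: if_cong)
      then have "outer3 (axis i 1) (v k) (axis k 1) \<bullet> \<beta> = 0" using \<beta> by metis
      then have "0 = (\<Sum>i'\<in>UNIV. \<Sum>j\<in>UNIV. axis i 1 $ i' * v k $ j * \<beta> $ i' $ j $ k)"
        unfolding inner by simp
      also have "\<dots> = (\<Sum>i'\<in>UNIV. if i' = i then \<Sum>j\<in>UNIV. v k $ j * \<beta> $ i $ j $ k else 0)"
        by (intro sum.cong) (auto simp: axis_def)
      finally show ?thesis by simp
    qed
    have left: "(\<Sum>i\<in>UNIV. u k $ i * \<beta> $ i $ j $ k) = 0" for j k
    proof -
      have "outer_sum_deriv z (0, axis k (axis j 1), 0) = outer3 (u k) (axis j 1) (axis k 1)"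
        unfolding outer_sum_deriv_def z_def
        by (simp add: zero ax if_distrib[of "\<lambda>r. outer3 _ r _"] cong: if_cong)
      then have "outer3 (u k) (axis j 1) (axis k 1) \<bullet> \<beta> = 0" using \<beta> by metis
      then have "0 = (\<Sum>i\<in>UNIV. \<Sum>j'\<in>UNIV. u k $ i * axis j 1 $ j' * \<beta> $ i $ j' $ k)"
        unfolding inner by simp
      also have "\<dots> = (\<Sum>i\<in>UNIV. \<Sum>j'\<in>UNIV. if j' = j then u k $ i * \<beta> $ i $ j $ k else 0)"
        by (intro sum.cong) (auto simp: axis_def)
      finally show ?thesis by simp
    qed
    have vanish: "(\<Sum>i\<in>UNIV. \<Sum>j\<in>UNIV. u l $ i * v l $ j * \<beta> $ i $ j $ k) = 0" for k l
    proof -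
      have "outer_sum_deriv z (0, 0, axis l (axis k 1)) = outer3 (u l) (v l) (axis k 1)"
        unfolding outer_sum_deriv_def z_def
        by (simp add: zero ax if_distrib[of "\<lambda>r. outer3 _ _ r"] cong: if_cong)
      then have "outer3 (u l) (v l) (axis k 1) \<bullet> \<beta> = 0" using \<beta> by metis
      then show ?thesis unfolding inner .
    qed
    have "\<beta> $ i $ j $ k = 0" for i j k
    proof -
      define B where "B = (\<lambda>i j. \<beta> $ (inv f i) $ (inv g j) $ k)"
      have fs: "(\<Sum>i\<le>a. F i) = (\<Sum>i\<in>UNIV. F (f i))" for F :: "nat \<Rightarrow> real"
        by (rule sum.reindex_bij_betw[OF f, symmetric])
      have gs: "(\<Sum>j\<le>b. F j) = (\<Sum>j\<in>UNIV. F (g j))" for F :: "nat \<Rightarrow> real"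
        by (rule sum.reindex_bij_betw[OF g, symmetric])
      have "B (f i) (g j) = 0"
      proof (rule bilinear_form_eq_0_if_singular[where I = UNIV and k = k and x = x and a = a and b = b])
        show "(\<Sum>i\<le>a. B i j * x k ^ i) = 0" for j
          using left[of k "inv g j"] unfolding fs by (simp add: B_def u_def inv mult.commute)
        show "(\<Sum>j\<le>b. B i j * (x k ^ a) ^ j) = 0" for i
          using right[of k "inv f i"] unfolding gs by (simp add: B_def v_def inv mult.commute)
        show "(\<Sum>i\<le>a. \<Sum>j\<le>b. B i j * x l ^ i * (x l ^ a) ^ j) = 0" for l
          using vanish[of l k] unfolding fs gs by (simp add: B_def u_def v_def inv mult_ac)
        show "f i \<le> a" "g j \<le> b" using f g by (auto simp: bij_betw_def)
      qed (use x assms in auto)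
      then show ?thesis by (simp add: B_def inv)
    qed
    then show "\<beta> = 0" by (simp add: vec_eq_iff)
  qed
  moreover have "d = 0" if d: "contract (outer_sum z) d = 0" for d
  proof -
    have c: "contract (outer_sum z) d $ i $ j = (\<Sum>l\<in>UNIV. d $ l * (u l $ i * v l $ j))" for i j
      unfolding outer_sum_def z_def
      by (simp add: contract_sum contract_outer3 inner_axis' mult.assoc)
    have "(\<Sum>l\<in>UNIV. d $ l * x l ^ e) = 0" if e: "e \<le> a * b" for e
    proof -
      \<comment> \<open>The monomial \<open>x\<^sup>i y\<^sup>j\<close> with \<open>e = i + a j\<close> restricts to \<open>x\<^sup>e\<close> on the curve.\<close>
      have "e mod a \<le> a" "e div a \<le> b"
        using mod_less_divisor[of a e] div_le_mono[OF e, of a] assms(4) by simp_all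
      then obtain i j where ij: "f i = e mod a" "g j = e div a"
        using f g unfolding bij_betw_def by (metis atMost_iff imageE)
      have "x l ^ f i * (x l ^ a) ^ g j = x l ^ e" for l
        unfolding ij power_mult[symmetric] power_add[symmetric] by (simp add: add.commute)
      then show ?thesis using d c[of i j] by (simp add: u_def v_def)
    qed
    then have "d $ k = 0" for k
      using assms(3) x(1) by (intro moments_eq_0[of UNIV "a * b" x "\<lambda>l. d $ l" k]) auto
    then show ?thesis by (simp add: vec_eq_iff)
  qed
  ultimately show ?thesis by blast
qed

section \<open>Typical ranks\<close>

lemma sum_of_outer3I: "T = (\<Sum>l<r. outer3 (a l) (b l) (c l)) \<Longrightarrow> sum_of_outer3 r T"
  unfolding sum_of_outer3_def by blast

lemma sum_lessThan_add: "(\<Sum>l<r + r'. F l) = (\<Sum>l<r. F l) + (\<Sum>l<r'. F (r + l))"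
  for F :: "nat \<Rightarrow> 'a::comm_monoid_add"
  by (induction r') (simp_all add: add.assoc)

lemma sum_of_outer3_add:
  assumes "sum_of_outer3 r S" "sum_of_outer3 r' T"
  shows "sum_of_outer3 (r + r') (S + T)"
proof -
  obtain a b c where S: "S = (\<Sum>l<r. outer3 (a l) (b l) (c l))"
    using assms(1) unfolding sum_of_outer3_def by blast
  obtain a' b' c' where T: "T = (\<Sum>l<r'. outer3 (a' l) (b' l) (c' l))"
    using assms(2) unfolding sum_of_outer3_def by blast
  let ?join = "\<lambda>f f' l. if l < r then f l else f' (l - r)"
  have "S + T = (\<Sum>l<r + r'. outer3 (?join a a' l) (?join b b' l) (?join c c' l))"
    unfolding S T sum_lessThan_add by (intro arg_cong2[of _ _ _ _ plus] sum.cong) simp_all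
  then show ?thesis by (rule sum_of_outer3I)
qed

lemma sum_of_outer3_iff_outer_sum:
  "sum_of_outer3 CARD('p) T \<longleftrightarrow> (\<exists>z. T = outer_sum z)"
  for T :: "('m::finite, 'n::finite, 'p::finite) tensor3"
proof -
  obtain q :: "nat \<Rightarrow> 'p" where q: "bij_betw q {..<CARD('p)} UNIV"
    using ex_bij_betw_nat_finite[of "UNIV :: 'p set"] by (auto simp: atLeast0LessThan)
  have r: "(\<Sum>l<CARD('p). F (q l)) = (\<Sum>l\<in>UNIV. F l)" for F :: "'p \<Rightarrow> ('m, 'n, 'p) tensor3"
    by (rule sum.reindex_bij_betw[OF q])
  show ?thesis
  proof
    assume "sum_of_outer3 CARD('p) T"
    then obtain a b c where T: "T = (\<Sum>l<CARD('p). outer3 (a l) (b l) (c l))"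
      unfolding sum_of_outer3_def by blast
    let ?q = "inv_into {..<CARD('p)} q"
    have "T = (\<Sum>l<CARD('p). outer3 (a (?q (q l))) (b (?q (q l))) (c (?q (q l))))"
      unfolding T using q by (intro sum.cong) (auto simp: bij_betw_def inv_into_f_f)
    also have "\<dots> = (\<Sum>l\<in>UNIV. outer3 (a (?q l)) (b (?q l)) (c (?q l)))"
      by (rule r[of "\<lambda>l. outer3 (a (?q l)) (b (?q l)) (c (?q l))"])
    also have "\<dots> = outer_sum (\<chi> l. a (?q l), \<chi> l. b (?q l), \<chi> l. c (?q l))"
      by (simp add: outer_sum_def)
    finally show "\<exists>z. T = outer_sum z" by blast
  next
    assume "\<exists>z. T = outer_sum z"
    then obtain z where "T = outer_sum z" by blast
    then have "T = (\<Sum>l<CARD('p). outer3 (fst z $ q l) (fst (snd z) $ q l) (snd (snd z) $ q l))"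
      by (simp add: outer_sum_def r[of "\<lambda>l. outer3 (fst z $ l) (fst (snd z) $ l) (snd (snd z) $ l)"])
    then show "sum_of_outer3 CARD('p) T"
      by (rule sum_of_outer3I)
  qed
qed

lemma tensor_rank_le: "sum_of_outer3 r T \<Longrightarrow> tensor_rank T \<le> r"
  unfolding tensor_rank_def by (rule Least_le)

lemma sum_of_outer3_tensor_rank: "sum_of_outer3 (tensor_rank T) T"
  unfolding tensor_rank_def using ex_sum_of_outer3 by (rule LeastI_ex)

lemma typical_rank_card:
  assumes "CARD('m :: finite) = a + 1" "CARD('n :: finite) = b + 1" "CARD('p :: finite) = a * b + 1"
    "0 < a"
  shows "typical_rank TYPE(('m, 'n, 'p) tensor3) CARD('p)"
proof -
  obtain z :: "('m, 'n, 'p) factors" where z: "surj (outer_sum_deriv z)"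
    "\<And>d. contract (outer_sum z) d = 0 \<Longrightarrow> d = 0"
    using exists_submersive_factors[OF assms] by blast
  define U where "U = interior (range outer_sum) \<inter> {T :: ('m, 'n, 'p) tensor3. \<forall>d. contract T d = 0 \<longrightarrow> d = 0}"
  have "open {T :: ('m, 'n, 'p) tensor3. \<forall>d. contract T d = 0 \<longrightarrow> d = 0}"
    using open_contract_avoids[of "{0}"] by simp
  then have "open U" unfolding U_def by (intro open_Int open_interior)
  moreover have "outer_sum z \<in> U" unfolding U_def using outer_sum_interior[OF z(1)] z(2) by auto
  moreover have "tensor_rank T = CARD('p)" if "T \<in> U" for T
  proof (rule antisym)
    have "\<exists>z. T = outer_sum z" using that interior_subset unfolding U_def by blast
    then show "tensor_rank T \<le> CARD('p)" by (intro tensor_rank_le) (simp add: sum_of_outer3_iff_outer_sum)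
    show "CARD('p) \<le> tensor_rank T"
      using that unfolding U_def by (intro rank_ge_if_contract_inj[OF _ sum_of_outer3_tensor_rank]) auto
  qed
  ultimately show ?thesis unfolding typical_rank_def by blast
qed

text \<open>
  The tensor \<open>T\<close> is chosen of least rank in \<open>U\<close>, so it remains to find an open part of \<open>U\<close> on which the rank is
  at most that of \<open>T\<close>. The summand \<open>R\<close> with the surplus terms of a decomposition of \<open>T\<close> stays fixed, while
  the other terms move towards a submersive point.
\<close>

lemma exists_typical_rank_on_open:
  fixes U :: "('m::finite, 'n::finite, 'p::finite) tensor3 set"
  assumes z: "\<exists>z :: ('m, 'n, 'p) factors. surj (outer_sum_deriv z)"
    and U: "open U" "U \<noteq> {}" and ge: "\<And>T. T \<in> U \<Longrightarrow> CARD('p) \<le> tensor_rank T"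
  shows "\<exists>T\<in>U. typical_rank TYPE(('m, 'n, 'p) tensor3) (tensor_rank T)"
proof -
  obtain T where T: "T \<in> U" "\<And>S. S \<in> U \<Longrightarrow> tensor_rank T \<le> tensor_rank S"
    using ex_has_least_nat[of "\<lambda>T. T \<in> U" _ tensor_rank] U(2) by blast
  define r where "r = tensor_rank T - CARD('p)"
  have r: "tensor_rank T = CARD('p) + r" using ge[OF T(1)] by (simp add: r_def)
  obtain a b c where abc: "T = (\<Sum>l<CARD('p) + r. outer3 (a l) (b l) (c l))"
    using sum_of_outer3_tensor_rank[of T] unfolding r sum_of_outer3_def by blast
  define R where "R = (\<Sum>l<r. outer3 (a (CARD('p) + l)) (b (CARD('p) + l)) (c (CARD('p) + l)))"
  have R: "sum_of_outer3 r R" unfolding R_def by (rule sum_of_outer3I) (rule refl)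
  have "sum_of_outer3 CARD('p) (\<Sum>l<CARD('p). outer3 (a l) (b l) (c l))"
    by (rule sum_of_outer3I) (rule refl)
  then obtain z0 where z0: "T = outer_sum z0 + R"
    unfolding abc R_def sum_lessThan_add sum_of_outer3_iff_outer_sum by auto
  obtain z1 :: "('m, 'n, 'p) factors" where z1: "surj (outer_sum_deriv z1)" using z by blast
  define w where "w = z1 - z0"
  have line: "isCont (\<lambda>s. z0 + s *\<^sub>R w) 0" by (intro continuous_intros)
  have "isCont outer_sum (z0 + 0 *\<^sub>R w)"
    by (rule has_derivative_continuous[OF has_derivative_outer_sum])
  from isCont_o2[OF line this] have "isCont (\<lambda>s. outer_sum (z0 + s *\<^sub>R w) + R) 0"
    by (rule continuous_add) (rule continuous_const)
  then have "((\<lambda>s. outer_sum (z0 + s *\<^sub>R w) + R) \<longlongrightarrow> T) (at 0)"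
    unfolding z0 isCont_def by simp
  then have "\<forall>\<^sub>F s in at 0. outer_sum (z0 + s *\<^sub>R w) + R \<in> U"
    using U(1) T(1) by (rule topological_tendstoD)
  then obtain \<epsilon> where \<epsilon>: "0 < \<epsilon>" "\<And>s. s \<noteq> 0 \<Longrightarrow> dist s 0 < \<epsilon> \<Longrightarrow> outer_sum (z0 + s *\<^sub>R w) + R \<in> U"
    unfolding eventually_at by auto
  obtain s where s: "0 < s" "s < \<epsilon>" "surj (outer_sum_deriv (z0 + s *\<^sub>R w))"
    using surj_outer_sum_deriv_dense[of z0 w \<epsilon>] z1 \<epsilon>(1) by (auto simp: w_def)
  define W where "W = U \<inter> (\<lambda>S. S - R) -` interior (range outer_sum)"
  have "open W"
    unfolding W_def by (intro open_Int U(1) open_vimage continuous_intros) simp_all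
  moreover have "outer_sum (z0 + s *\<^sub>R w) + R \<in> W"
    unfolding W_def using \<epsilon>(2)[of s] s outer_sum_interior[OF s(3)] by auto
  moreover have "tensor_rank S = tensor_rank T" if "S \<in> W" for S
  proof (rule antisym)
    have "\<exists>z. S - R = outer_sum z" using that interior_subset unfolding W_def by blast
    then have "sum_of_outer3 (CARD('p) + r) ((S - R) + R)"
      by (intro sum_of_outer3_add R) (simp add: sum_of_outer3_iff_outer_sum)
    then show "tensor_rank S \<le> tensor_rank T" unfolding r by (intro tensor_rank_le) simp
    show "tensor_rank T \<le> tensor_rank S" using T(2) that unfolding W_def by blast
  qed
  ultimately show ?thesis unfolding typical_rank_def using T(1) by blast
qed

theorem theorem1p3:
  fixes m n p :: nat
  assumes "m \<ge> 3" and "n \<ge> 3"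
    and "p = (m - 1) * (n - 1) + 1"
    and "CARD('m::finite) = m" and "CARD('n::finite) = n" and "CARD('p::finite) = p"
    and "\<not> bit_disjoint (m - 1) (n - 1)"
  shows "plural_typical_ranks TYPE(('m, 'n, 'p) tensor3)"
proof -
  define a b where "a = m - 1" and "b = n - 1"
  have ab: "CARD('m) = a + 1" "CARD('n) = b + 1" "CARD('p) = a * b + 1" "0 < a"
    using assms(1-6) by (simp_all add: a_def b_def)
  obtain s where s: "bit a s" "bit b s"
    using assms(7) unfolding bit_disjoint_def a_def b_def by blast
  let ?U = "{T :: ('m, 'n, 'p) tensor3. avoids_rank_one T}"
  have gt: "CARD('p) < tensor_rank T" if "T \<in> ?U" for T :: "('m, 'n, 'p) tensor3"
    using that by (intro rank_gt_if_avoids_rank_one[OF _ sum_of_outer3_tensor_rank]) simp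
  have "\<exists>T\<in>?U. typical_rank TYPE(('m, 'n, 'p) tensor3) (tensor_rank T)"
  proof (rule exists_typical_rank_on_open)
    show "\<exists>z :: ('m, 'n, 'p) factors. surj (outer_sum_deriv z)"
      using exists_submersive_factors[OF ab] by blast
    show "open ?U" by (rule open_avoids_rank_one)
    show "?U \<noteq> {}" using exists_avoids_rank_one[OF ab(1-3) s] by blast
    show "CARD('p) \<le> tensor_rank T" if "T \<in> ?U" for T
      using gt[OF that] by simp
  qed
  then obtain T :: "('m, 'n, 'p) tensor3" where
    T: "T \<in> ?U" "typical_rank TYPE(('m, 'n, 'p) tensor3) (tensor_rank T)" by blast
  have "CARD('p) \<noteq> tensor_rank T" using gt[OF T(1)] by simp
  with typical_rank_card[OF ab] T(2) show ?thesis
    unfolding plural_typical_ranks_def by blast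
qed

end
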